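(* Let the centered stationary Gaussian field $G$ and its covariance $\mathcal C$ satisfy the standing assumptions (stated in the context) for some $\beta>0$. For $f\in C^1([0,1])$ let $u_\varepsilon$ be the solution of $$(a(\tfrac{x}{\varepsilon})u_\varepsilon'(x))'=f'(x)\ \text{ on }(0,1),\qquad u_\varepsilon(0)=u_\varepsilon(1)=0,$$ and let $\bar u$ be the solution of $$(\bar a\,\bar u'(x))'=f'(x)\ \text{ on }(0,1),\qquad \bar u(0)=\bar u(1)=0,$$ where $\bar a=\exp(-\tfrac{\mathcal C(0)}{2})$. Then there exists a finite constant $M$, independent of $\varepsilon$, $x$ and $f$, such that for all $\varepsilon\in(0,\frac12]$ and all $x\in[0,1]$ $$\mathbb E\big[|u_\varepsilon(x)-\bar u(x)|^2\big]^{\frac12}+\mathbb E\Big[\Big|u_\varepsilon'(x)-\bar u'(x)\frac{\bar a}{a(x/\varepsilon)}\Big|^2\Big]^{\frac12}\le M\,\|f\|_{L^2(0,1)}\,\pi_\beta(\varepsilon),$$ where $$\pi_\beta(\varepsilon)=\begin{cases}\varepsilon^{\beta/2}&\text{if }0<\beta<1,\\ \sqrt{\varepsilon}\,|\log\varepsilon|^{1/2}&\text{if }\beta=1,\\ \sqrt{\varepsilon}&\text{if }\beta>1.\end{cases}$$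
   Context: Standing assumptions. $G:\mathbb R\to\mathbb R$ is a stationary centered Gaussian random field with covariance function $\mathcal C:\mathbb R\to\mathbb R$, that is, $\mathbb E[G(x)G(y)]=\mathcal C(x-y)$, where $\mathcal C$ is Hölder continuous at zero. For the given $\beta>0$ and a finite constant $K$ one has $|\mathcal C(x)|\le K(1+|x|)^{-\beta}$ for all $x\in\mathbb R$. Moreover $\mathcal C=\mathcal C^\circ\star\mathcal C^\circ$ (convolution) for some $\mathcal C^\circ$ satisfying, for all $x\in\mathbb R$, $\sup_{B(x)}|\mathcal C^\circ|\le K(1+|x|)^{-\frac{1+\beta}{2}}\ell_\beta(x)$, with $\ell_\beta(x)=1$ if $\beta\neq1$ and $\ell_1(x)=\log(2+|x|)^{-1/2}$, where $B(x)$ is the unit ball centered at $x$. Realizations of $G$ are almost surely continuous (continuous version). The random coefficient field is $a(x)=\exp(G(x))$. The solution $u_\varepsilon\in C^1([0,1])$ is random, with $$u_\varepsilon'(x)=\frac{1}{a(x/\varepsilon)}\Big(f(x)-\Big(\int_0^1\frac{1}{a(y/\varepsilon)}dy\Big)^{-1}\int_0^1\frac{f(y)}{a(y/\varepsilon)}dy\Big).$$ *)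

theory Defs
  imports "HOL-Probability.Probability"
begin

(* The library's normal_density requires a positive standard deviation to be a probability density;
   the a.s. constant case is the Gaussian law of variance zero. *)
definition gaussian_rv :: "'w measure \<Rightarrow> ('w \<Rightarrow> real) \<Rightarrow> bool" where
  "gaussian_rv P X \<longleftrightarrow> X \<in> borel_measurable P \<and>
     ((\<exists>m. AE \<omega> in P. X \<omega> = m) \<or>
      (\<exists>m s. s > 0 \<and> distributed P lborel X (normal_density m s)))"

(* Finite-dimensional distributions are multivariate normal iff all linear combinations are
   univariate normal. *)
definition gaussian_field :: "'w measure \<Rightarrow> (real \<Rightarrow> 'w \<Rightarrow> real) \<Rightarrow> bool" where
  "gaussian_field P G \<longleftrightarrow>
     (\<forall>I c. finite I \<longrightarrow> gaussian_rv P (\<lambda>\<omega>. \<Sum>x\<in>I. c x * G x \<omega>))"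

definition stationary_centered_gaussian_field ::
    "'w measure \<Rightarrow> (real \<Rightarrow> 'w \<Rightarrow> real) \<Rightarrow> (real \<Rightarrow> real) \<Rightarrow> bool" where
  "stationary_centered_gaussian_field P G C \<longleftrightarrow>
     gaussian_field P G \<and>
     (\<forall>x. (\<integral>\<omega>. G x \<omega> \<partial>P) = 0) \<and>
     (\<forall>x y. (\<integral>\<omega>. G x \<omega> * G y \<omega> \<partial>P) = C (x - y))"

definition holder_continuous_at_zero :: "(real \<Rightarrow> real) \<Rightarrow> bool" where
  "holder_continuous_at_zero C \<longleftrightarrow>
     (\<exists>\<alpha> L \<delta>. 0 < \<alpha> \<and> \<alpha> \<le> 1 \<and> \<delta> > 0 \<and>
        (\<forall>x. \<bar>x\<bar> < \<delta> \<longrightarrow> \<bar>C x - C 0\<bar> \<le> L * \<bar>x\<bar> powr \<alpha>))"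

definition fun_convolution :: "(real \<Rightarrow> real) \<Rightarrow> (real \<Rightarrow> real) \<Rightarrow> real \<Rightarrow> real" where
  "fun_convolution g h x = (\<integral>y. g (x - y) * h y \<partial>lebesgue)"

definition ell :: "real \<Rightarrow> real \<Rightarrow> real" where
  "ell \<beta> x = (if \<beta> = 1 then ln (2 + \<bar>x\<bar>) powr (- (1/2)) else 1)"

definition rate :: "real \<Rightarrow> real \<Rightarrow> real" where
  "rate \<beta> \<epsilon> =
     (if \<beta> < 1 then \<epsilon> powr (\<beta> / 2)
      else if \<beta> = 1 then sqrt \<epsilon> * \<bar>ln \<epsilon>\<bar> powr (1/2)
      else sqrt \<epsilon>)"

(* Derivative on [0,1], one-sided at the two end points. *)
definition deriv01 :: "(real \<Rightarrow> real) \<Rightarrow> real \<Rightarrow> real" where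
  "deriv01 g x = vector_derivative g (at x within {0..1})"

definition C1_on01 :: "(real \<Rightarrow> real) \<Rightarrow> bool" where
  "C1_on01 g \<longleftrightarrow>
     (\<forall>x\<in>{0..1}. g differentiable (at x within {0..1})) \<and> continuous_on {0..1} (deriv01 g)"

(* u in C^1([0,1]) solves (A u')' = f' on (0,1) with u(0) = u(1) = 0. As A is in general only
   continuous, it is the flux A u', not u', that is required to be differentiable. *)
definition dirichlet_solution ::
    "(real \<Rightarrow> real) \<Rightarrow> (real \<Rightarrow> real) \<Rightarrow> (real \<Rightarrow> real) \<Rightarrow> bool" where
  "dirichlet_solution A f u \<longleftrightarrow>
     C1_on01 u \<and>
     (\<forall>x\<in>{0<..<1}. ((\<lambda>y. A y * deriv01 u y) has_real_derivative deriv01 f x) (at x)) \<and>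
     u 0 = 0 \<and> u 1 = 0"

definition L2_norm01 :: "(real \<Rightarrow> real) \<Rightarrow> real" where
  "L2_norm01 f = sqrt (set_lebesgue_integral lborel {0<..<1} (\<lambda>x. (f x)\<^sup>2))"

(* E[|X|^2]^(1/2) as an extended nonnegative number, infinite if X is not square integrable.
   The value only depends on X up to P-null sets. *)
definition L2_norm_prob :: "'w measure \<Rightarrow> ('w \<Rightarrow> real) \<Rightarrow> ennreal" where
  "L2_norm_prob P X =
     (let I = (\<integral>\<^sup>+\<omega>. ennreal (\<bar>X \<omega>\<bar>\<^sup>2) \<partial>P)
      in if I = \<infinity> then \<infinity> else ennreal (sqrt (enn2real I)))"

end

theory Submission
  imports Defs
begin

text \<open>
In one dimension both equations integrate explicitly. Write \<open>b(s) = exp (- G (s/\<epsilon>))\<close> and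
\<open>B = 1/abar\<close>, which is the expectation of \<open>b\<close>. The two solutions have derivatives \<open>b (f - c)\<close> and
\<open>B (f - F)\<close>, with \<open>F = \<integral> f\<close> and \<open>c = \<integral> b f / \<integral> b\<close>. With \<open>g = f - F\<close> and
\<open>Z(x) = \<integral>\<^sub>0\<^sup>x (b - B) g\<close>, the constant satisfies \<open>c - F = Z(1) / \<integral> b\<close>, so that pathwise
(lemma \<open>homogenization_error_pathwise\<close>)

  \<^item> \<open>|u(x) - ubar(x)| \<le> |Z(x)| + |Z(1)|\<close>,

  \<^item> \<open>|u'(x) - ubar'(x) abar / a(x/\<epsilon>)| = b(x) |Z(1)| / \<integral> b\<close>.

The first error only asks for the second moment of \<open>Z\<close>, which is a double integral of the covariance
of \<open>b\<close>. The second contains the random factor \<open>b(x) / \<integral> b\<close>. Moments of \<open>Z\<close> of order higher than two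
can be avoided: by Jensen's inequality \<open>1 / (\<integral> b)\<^sup>2 \<le> \<integral> 1 / b(y)\<^sup>2 dy\<close>
(lemma \<open>inverse_square_integral_le\<close>), and for fixed \<open>x\<close> and \<open>y\<close> the weight
\<open>b(x)\<^sup>2 / b(y)\<^sup>2 = exp (2 G (y/\<epsilon>) - 2 G (x/\<epsilon>))\<close> is the exponential of a Gaussian variable. Weighting by it
merely shifts the mean of the field (lemma \<open>tilted_covariance\<close>), and the shift decays away from
\<open>x\<close> and \<open>y\<close> like the covariance. Hence the weighted correlation of \<open>b(s) - B\<close> and \<open>b(t) - B\<close> is bounded, up to a
constant, by the kernel
\<open>\<kappa>(s - t) = (1 + |s - t|/\<epsilon>) powr (- \<beta>)\<close> plus a product of two sums of such kernels centred at \<open>x\<close> and \<open>y\<close>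
(lemma \<open>tilted_covariance_le\<close>).

The rate appears because the integral of \<open>\<kappa>\<close> over the unit interval is at most a constant times
the squared rate (lemma \<open>integral_power_kernel_le_rate\<close>), and Schur's test
(lemma \<open>second_moment_of_integral_Schur\<close>) turns this into a bound of the weighted second moment of \<open>Z\<close> by
the squared norm of \<open>g\<close>, which is at most that of \<open>f\<close>.
\<close>

section \<open>Exponential moments of Gaussian fields\<close>

lemma abs_mult_le_half_sum_squares: "\<bar>u * v\<bar> \<le> (u\<^sup>2 + v\<^sup>2) / 2" for u v :: real
proof -
  have "0 \<le> (\<bar>u\<bar> - \<bar>v\<bar>)\<^sup>2" by auto
  then show ?thesis
    by (simp add: power2_diff abs_mult mult.assoc)
qed

lemma gaussian_rv_exponential_moment:
  assumes "prob_space P" "gaussian_rv P X" and mean: "(\<integral>\<omega>. X \<omega> \<partial>P) = 0"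
  shows "integrable P X" "integrable P (\<lambda>\<omega>. (X \<omega>)\<^sup>2)" "integrable P (\<lambda>\<omega>. exp (X \<omega>))"
    and "(\<integral>\<omega>. exp (X \<omega>) \<partial>P) = exp ((\<integral>\<omega>. (X \<omega>)\<^sup>2 \<partial>P) / 2)"
proof -
  interpret prob_space P by fact
  have X [measurable]: "X \<in> borel_measurable P"
    using assms(2) by (simp add: gaussian_rv_def)
  have "integrable P X \<and> integrable P (\<lambda>\<omega>. (X \<omega>)\<^sup>2) \<and> integrable P (\<lambda>\<omega>. exp (X \<omega>)) \<and>
    (\<integral>\<omega>. exp (X \<omega>) \<partial>P) = exp ((\<integral>\<omega>. (X \<omega>)\<^sup>2 \<partial>P) / 2)"
    using assms(2) unfolding gaussian_rv_def
  proof (elim conjE disjE exE)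
    fix m assume m: "AE \<omega> in P. X \<omega> = m"
    have "(\<integral>\<omega>. X \<omega> \<partial>P) = (\<integral>\<omega>. m \<partial>P)"
      by (rule integral_cong_AE) (use m in auto)
    then have "m = 0"
      using mean by (simp add: prob_space)
    have *: "integrable P (\<lambda>\<omega>. h (X \<omega>)) \<and> (\<integral>\<omega>. h (X \<omega>) \<partial>P) = h 0"
      if [measurable]: "h \<in> borel_measurable borel" for h :: "real \<Rightarrow> real"
    proof
      have ae: "AE \<omega> in P. h (X \<omega>) = h 0"
        using m \<open>m = 0\<close> by auto
      show "integrable P (\<lambda>\<omega>. h (X \<omega>))"
        using integrable_cong_AE[of "\<lambda>\<omega>. h (X \<omega>)" P "\<lambda>\<omega>. h 0"] ae by simp
      show "(\<integral>\<omega>. h (X \<omega>) \<partial>P) = h 0"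
        using integral_cong_AE[of "\<lambda>\<omega>. h (X \<omega>)" P "\<lambda>\<omega>. h 0"] ae by (simp add: prob_space)
    qed
    show ?thesis
      using *[of "\<lambda>z. z"] *[of "\<lambda>z. z\<^sup>2"] *[of exp] by simp
  next
    fix m s :: real assume s: "s > 0" and D: "distributed P lborel X (normal_density m s)"
    have "m = 0"
      using normal_distributed_expectation[OF s D] mean by simp
    note D = D[unfolded \<open>m = 0\<close>]
    have tr: "integrable P (\<lambda>\<omega>. h (X \<omega>)) \<and> (\<integral>\<omega>. h (X \<omega>) \<partial>P) = I"
      if [measurable]: "h \<in> borel_measurable borel"
        and "has_bochner_integral lborel (\<lambda>z. normal_density 0 s z * h z) I" for h :: "real \<Rightarrow> real" and I
      using that(2) distributed_integrable[OF D, of h] distributed_integral[OF D, of h]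
      by (simp add: has_bochner_integral_iff)
    have 1: "has_bochner_integral lborel (\<lambda>z. normal_density 0 s z * z) 0"
      using normal_moment_odd[OF s, of 0 0] by simp
    have 2: "has_bochner_integral lborel (\<lambda>z. normal_density 0 s z * z\<^sup>2) (s\<^sup>2)"
      using normal_moment_even[OF s, of 0 1] by simp
    \<comment> \<open>Completing the square: the exponential tilt of a normal density is a shifted normal density.\<close>
    have tilt: "normal_density 0 s z * exp z = exp (s\<^sup>2 / 2) * normal_density (s\<^sup>2) s z" for z
    proof -
      have "- (z - 0)\<^sup>2 / (2 * s\<^sup>2) + z = s\<^sup>2 / 2 + - (z - s\<^sup>2)\<^sup>2 / (2 * s\<^sup>2)"
        using s by (simp add: field_simps power2_eq_square)
      then show ?thesis
        unfolding normal_density_def by (simp add: exp_add[symmetric] mult.commute)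
    qed
    have "has_bochner_integral lborel (normal_density (s\<^sup>2) s) 1"
      using s by (simp add: has_bochner_integral_iff)
    then have 3: "has_bochner_integral lborel (\<lambda>z. normal_density 0 s z * exp z) (exp (s\<^sup>2 / 2))"
      unfolding tilt using has_bochner_integral_mult_right[of "exp (s\<^sup>2 / 2)"] by fastforce
    show ?thesis
      using tr[OF _ 1] tr[OF _ 2] tr[OF _ 3] by simp
  qed
  then show "integrable P X" "integrable P (\<lambda>\<omega>. (X \<omega>)\<^sup>2)" "integrable P (\<lambda>\<omega>. exp (X \<omega>))"
    "(\<integral>\<omega>. exp (X \<omega>) \<partial>P) = exp ((\<integral>\<omega>. (X \<omega>)\<^sup>2 \<partial>P) / 2)"
    by auto
qed

lemma gaussian_rv_cong_AE:
  assumes "gaussian_rv P X" "AE \<omega> in P. Y \<omega> = X \<omega>" and [measurable]: "Y \<in> borel_measurable P"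
  shows "gaussian_rv P Y"
proof -
  have [measurable]: "X \<in> borel_measurable P"
    using assms(1) by (simp add: gaussian_rv_def)
  have "distr P lborel Y = distr P lborel X"
    by (rule distr_cong_AE) (use assms(2) in auto)
  moreover have "(AE \<omega> in P. Y \<omega> = m) \<longleftrightarrow> (AE \<omega> in P. X \<omega> = m)" for m
    using assms(2) by (auto elim: AE_mp)
  ultimately show ?thesis
    using assms(1) by (simp add: gaussian_rv_def distributed_def)
qed

text \<open>Points of the field may be repeated: merging coefficients at equal points leads back to a sum over a
set. The exponential moments below are taken at up to four points that may coincide.\<close>

lemma gaussian_rv_weighted_sum:
  fixes J :: "'i set" and p c :: "'i \<Rightarrow> real"
  assumes "gaussian_field P G" "finite J"
  shows "gaussian_rv P (\<lambda>\<omega>. \<Sum>i\<in>J. c i * G (p i) \<omega>)"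
proof -
  have "(\<Sum>i\<in>J. c i * G (p i) \<omega>) = (\<Sum>z\<in>p ` J. (\<Sum>i\<in>{i\<in>J. p i = z}. c i) * G z \<omega>)" for \<omega>
    by (subst sum.image_gen[OF \<open>finite J\<close>, of _ p]) (auto simp: sum_distrib_right intro!: sum.cong)
  then show ?thesis
    using assms by (simp add: gaussian_field_def)
qed

text \<open>Every expectation in the estimates is a linear combination of expectations of exponentials of field
values, so this formula expresses all of them through the covariance.\<close>

lemma gaussian_field_exponential_moment:
  fixes J :: "'i set" and p c :: "'i \<Rightarrow> real"
  assumes "prob_space P" and G: "stationary_centered_gaussian_field P G C" and J: "finite J"
  shows "integrable P (\<lambda>\<omega>. exp (\<Sum>i\<in>J. c i * G (p i) \<omega>))"
    and "(\<integral>\<omega>. exp (\<Sum>i\<in>J. c i * G (p i) \<omega>) \<partial>P)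
      = exp ((\<Sum>i\<in>J. \<Sum>j\<in>J. c i * c j * C (p i - p j)) / 2)"
proof -
  interpret prob_space P by fact
  have field: "gaussian_field P G" and mean: "\<And>x. (\<integral>\<omega>. G x \<omega> \<partial>P) = 0"
    and cov: "\<And>x y. (\<integral>\<omega>. G x \<omega> * G y \<omega> \<partial>P) = C (x - y)"
    using G by (auto simp: stationary_centered_gaussian_field_def)
  have "gaussian_rv P (G x)" for x
    using gaussian_rv_weighted_sum[OF field, of "{()}" "\<lambda>_. 1" "\<lambda>_. x"] by simp
  note Gx = gaussian_rv_exponential_moment[OF \<open>prob_space P\<close> this mean]
  have [measurable]: "G x \<in> borel_measurable P" for x
    using Gx(1) by auto
  have prod: "integrable P (\<lambda>\<omega>. G x \<omega> * G y \<omega>)" for x y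
  proof (rule Bochner_Integration.integrable_bound)
    show "integrable P (\<lambda>\<omega>. (G x \<omega>)\<^sup>2 + (G y \<omega>)\<^sup>2)"
      using Gx(2) by auto
    have "\<bar>u * v\<bar> \<le> u\<^sup>2 + v\<^sup>2" for u v :: real
      by (rule order_trans[OF abs_mult_le_half_sum_squares]) simp
    then show "AE \<omega> in P. norm (G x \<omega> * G y \<omega>) \<le> norm ((G x \<omega>)\<^sup>2 + (G y \<omega>)\<^sup>2)"
      by simp
  qed auto
  let ?X = "\<lambda>\<omega>. \<Sum>i\<in>J. c i * G (p i) \<omega>"
  have "(\<integral>\<omega>. ?X \<omega> \<partial>P) = (\<Sum>i\<in>J. c i * (\<integral>\<omega>. G (p i) \<omega> \<partial>P))"
    using Gx(1) by (subst Bochner_Integration.integral_sum) auto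
  then have "(\<integral>\<omega>. ?X \<omega> \<partial>P) = 0"
    by (simp add: mean)
  note X = gaussian_rv_exponential_moment[OF \<open>prob_space P\<close> gaussian_rv_weighted_sum[OF field J] this]
  show "integrable P (\<lambda>\<omega>. exp (?X \<omega>))"
    by (rule X(3))
  have "(\<integral>\<omega>. (?X \<omega>)\<^sup>2 \<partial>P) = (\<integral>\<omega>. (\<Sum>i\<in>J. \<Sum>j\<in>J. (c i * c j) * (G (p i) \<omega> * G (p j) \<omega>)) \<partial>P)"
    by (simp add: power2_eq_square sum_product mult_ac)
  also have "\<dots> = (\<Sum>i\<in>J. \<Sum>j\<in>J. c i * c j * C (p i - p j))"
    using prod by (subst Bochner_Integration.integral_sum; simp add: cov)
  finally show "(\<integral>\<omega>. exp (?X \<omega>) \<partial>P) = exp ((\<Sum>i\<in>J. \<Sum>j\<in>J. c i * c j * C (p i - p j)) / 2)"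
    using X(4) by simp
qed

section \<open>Integration over the unit interval\<close>

text \<open>Lebesgue measure on the closed unit interval as a probability measure of its own: functions that
are only continuous on \<^term>\<open>{0..1::real}\<close> are measurable for it, and Fubini applies with the whole
interval as the space.\<close>

definition unit_leb :: "real measure" where
  "unit_leb = restrict_space lborel {0..1}"

lemma space_unit_leb [simp]: "space unit_leb = {0..1}"
  by (simp add: unit_leb_def space_restrict_space)

lemma measurable_unit_leb_eq: "borel_measurable unit_leb = borel_measurable (restrict_space borel {0..1})"
  unfolding unit_leb_def by (rule measurable_cong_sets) (auto simp: sets_restrict_space)

lemma measurable_unit_leb [measurable (raw)]:
  "f \<in> borel_measurable borel \<Longrightarrow> f \<in> borel_measurable unit_leb"
  unfolding measurable_unit_leb_eq by (rule measurable_restrict_space1)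

lemma continuous_imp_measurable_unit_leb:
  "continuous_on {0..1} f \<Longrightarrow> f \<in> borel_measurable unit_leb"
  unfolding measurable_unit_leb_eq by (rule borel_measurable_continuous_on_restrict)

lemma prob_space_unit_leb: "prob_space unit_leb"
proof
  show "emeasure unit_leb (space unit_leb) = 1"
    unfolding unit_leb_def
    by (subst emeasure_restrict_space) (auto simp: space_restrict_space)
qed

interpretation unit_leb: prob_space unit_leb
  by (rule prob_space_unit_leb)

lemma integral_unit_leb:
  fixes f :: "real \<Rightarrow> real"
  shows "(\<integral>x. f x \<partial>unit_leb) = (\<integral>x. indicator {0..1} x * f x \<partial>lborel)"
  unfolding unit_leb_def by (subst integral_restrict_space) auto

lemma integrable_unit_leb:
  fixes f :: "real \<Rightarrow> real"
  assumes "continuous_on {0..1} f"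
  shows "integrable unit_leb f"
proof -
  have "compact (f ` {0..1})"
    by (rule compact_continuous_image[OF assms]) simp
  then obtain B where "\<forall>x\<in>{0..1}. norm (f x) \<le> B"
    by (auto dest!: compact_imp_bounded simp: bounded_iff)
  then show ?thesis
    by (intro unit_leb.integrable_const_bound[of _ B] AE_I2 continuous_imp_measurable_unit_leb assms) auto
qed

lemma integral_unit_leb_pos:
  fixes b :: "real \<Rightarrow> real"
  assumes b: "continuous_on {0..1} b" and b0: "\<And>s. s \<in> {0..1} \<Longrightarrow> b s > 0"
  shows "0 < (\<integral>s. b s \<partial>unit_leb)"
proof -
  have "(\<integral>s. 0 \<partial>unit_leb) < (\<integral>s. b s \<partial>unit_leb)"
    by (rule unit_leb.integral_less_AE_space)
      (auto simp: b0 unit_leb.emeasure_space_1[simplified] intro: integrable_unit_leb b)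
  then show ?thesis
    by simp
qed

lemma integral_unit_leb_derivative:
  fixes F f :: "real \<Rightarrow> real"
  assumes x: "x \<in> {0..1}"
    and F: "\<And>s. s \<in> {0..1} \<Longrightarrow> (F has_vector_derivative f s) (at s within {0..1})"
    and f: "continuous_on {0..1} f"
  shows "(\<integral>s. indicator {0..x} s * f s \<partial>unit_leb) = F x - F 0"
proof -
  have "(\<integral>s. indicator {0..x} s * f s \<partial>unit_leb) = (\<integral>s. indicator {0..x} s *\<^sub>R f s \<partial>lborel)"
    unfolding integral_unit_leb
    by (rule Bochner_Integration.integral_cong) (use x in \<open>auto simp: indicator_def\<close>)
  also have "\<dots> = F x - F 0"
  proof (rule integral_FTC_atLeastAtMost)
    show "(F has_vector_derivative f s) (at s within {0..x})" if "0 \<le> s" "s \<le> x" for s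
      by (rule has_vector_derivative_within_subset[OF F]) (use that x in auto)
    show "continuous_on {0..x} f"
      by (rule continuous_on_subset[OF f]) (use x in auto)
  qed (use x in auto)
  finally show ?thesis .
qed

lemma L2_norm01_unit_leb:
  assumes "continuous_on {0..1} f"
  shows "(L2_norm01 f)\<^sup>2 = (\<integral>x. (f x)\<^sup>2 \<partial>unit_leb)"
proof -
  have "(\<lambda>x. (f x)\<^sup>2) \<in> borel_measurable (restrict_space borel {0..1})"
    by (intro borel_measurable_continuous_on_restrict continuous_intros assms)
  then have [measurable]: "(\<lambda>x. indicator {0..1} x * (f x)\<^sup>2) \<in> borel_measurable borel"
    by (subst (asm) borel_measurable_restrict_space_iff) auto
  have eq: "indicator {0<..<1} x * (f x)\<^sup>2 = indicator {0<..<1} x * (indicator {0..1} x * (f x)\<^sup>2)" for x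
    by (auto simp: indicator_def)
  have [measurable]: "(\<lambda>x. indicator {0<..<1} x * (f x)\<^sup>2) \<in> borel_measurable borel"
    by (subst eq) measurable
  have "AE x in lborel. x \<noteq> (0::real)" "AE x in lborel. x \<noteq> (1::real)"
    by (rule AE_lborel_singleton)+
  then have *: "AE x in lborel. indicator {0..1} x * (f x)\<^sup>2 = indicator {0<..<1} x * (f x)\<^sup>2"
    by eventually_elim (auto simp: indicator_def)
  have "(\<integral>x. indicator {0..1} x * (f x)\<^sup>2 \<partial>lborel) = (\<integral>x. indicator {0<..<1} x * (f x)\<^sup>2 \<partial>lborel)"
    by (rule integral_cong_AE) (use * in auto)
  then show ?thesis
    by (simp add: L2_norm01_def integral_unit_leb set_lebesgue_integral_def)
qed

section \<open>The homogenization error for a fixed coefficient\<close>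

lemma C1_on01_continuous: "C1_on01 f \<Longrightarrow> continuous_on {0..1} f"
  by (auto simp: C1_on01_def continuous_on_eq_continuous_within intro: differentiable_imp_continuous_within)

text \<open>In one dimension the equation integrates explicitly: the flux minus the right-hand side is constant,
and the two boundary values determine the constant.\<close>

lemma dirichlet_solution_flux:
  assumes f: "C1_on01 f" and A: "continuous_on {0..1} A" and A0: "\<And>s. s \<in> {0..1} \<Longrightarrow> A s > 0"
    and sol: "dirichlet_solution A f u"
  defines "c \<equiv> (\<integral>s. f s / A s \<partial>unit_leb) / (\<integral>s. 1 / A s \<partial>unit_leb)"
  shows "\<And>s. s \<in> {0..1} \<Longrightarrow> deriv01 u s = (f s - c) / A s"
    and "\<And>x. x \<in> {0..1} \<Longrightarrow> u x = (\<integral>s. indicator {0..x} s * ((f s - c) / A s) \<partial>unit_leb)"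
proof -
  have vd: "(h has_vector_derivative deriv01 h s) (at s within {0..1})" if "C1_on01 h" "s \<in> {0..1}" for h s
    using that unfolding C1_on01_def deriv01_def by (simp add: vector_derivative_works)
  note cont = C1_on01_continuous
  have u: "C1_on01 u" "u 0 = 0" "u 1 = 0" and cu: "continuous_on {0..1} (deriv01 u)"
    and D: "\<And>x. 0 < x \<Longrightarrow> x < 1 \<Longrightarrow> ((\<lambda>y. A y * deriv01 u y) has_real_derivative deriv01 f x) (at x)"
    using sol by (auto simp: dirichlet_solution_def C1_on01_def)
  define k where "k = f 0 - A 0 * deriv01 u 0"
  have flux: "A s * deriv01 u s - f s = - k" if s: "s \<in> {0..1}" for s
  proof -
    have "A s * deriv01 u s - f s = A 0 * deriv01 u 0 - f 0"
    proof (rule DERIV_isconst2[of 0 1 "\<lambda>s. A s * deriv01 u s - f s"])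
      show "continuous_on {0..1} (\<lambda>s. A s * deriv01 u s - f s)"
        by (intro continuous_intros A cu cont f)
      show "((\<lambda>s. A s * deriv01 u s - f s) has_real_derivative 0) (at x)" if "0 < x" "x < 1" for x
      proof -
        have "(f has_real_derivative deriv01 f x) (at x)"
          using vd[OF f, of x] that at_within_interior[of x "{0..1}"]
          by (simp add: has_real_derivative_iff_has_vector_derivative)
        from DERIV_diff[OF D[OF that] this] show ?thesis
          by simp
      qed
    qed (use s in auto)
    then show ?thesis
      by (simp add: k_def)
  qed
  have du: "deriv01 u s = (f s - k) / A s" if "s \<in> {0..1}" for s
    using flux[OF that] A0[OF that] by (simp add: field_simps)
  have ux: "u x = (\<integral>s. indicator {0..x} s * ((f s - k) / A s) \<partial>unit_leb)" if x: "x \<in> {0..1}" for x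
  proof -
    have "u x = (\<integral>s. indicator {0..x} s * deriv01 u s \<partial>unit_leb)"
      using integral_unit_leb_derivative[OF x vd[OF u(1)] cu] u by simp
    also have "\<dots> = (\<integral>s. indicator {0..x} s * ((f s - k) / A s) \<partial>unit_leb)"
      by (rule Bochner_Integration.integral_cong) (auto simp: du)
    finally show ?thesis .
  qed
  have A_ne: "\<forall>s\<in>{0..1}. A s \<noteq> 0"
    using A0 by force
  have i: "integrable unit_leb (\<lambda>s. f s / A s)" "integrable unit_leb (\<lambda>s. 1 / A s)"
    by (intro integrable_unit_leb continuous_intros A cont f A_ne)+
  have pos: "0 < (\<integral>s. 1 / A s \<partial>unit_leb)"
    by (rule integral_unit_leb_pos) (use A0 A_ne in \<open>auto intro!: continuous_intros A\<close>)
  have "0 = (\<integral>s. f s / A s - k * (1 / A s) \<partial>unit_leb)"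
    unfolding u(3)[symmetric] by (subst ux) (auto intro!: Bochner_Integration.integral_cong simp: diff_divide_distrib)
  also have "\<dots> = (\<integral>s. f s / A s \<partial>unit_leb) - k * (\<integral>s. 1 / A s \<partial>unit_leb)"
    by (subst Bochner_Integration.integral_diff[OF i(1) integrable_mult_right[OF i(2)]]) (simp only: integral_mult_right_zero)
  finally have "k = c"
    using pos by (simp add: c_def field_simps)
  then show "\<And>s. s \<in> {0..1} \<Longrightarrow> deriv01 u s = (f s - c) / A s"
    and "\<And>x. x \<in> {0..1} \<Longrightarrow> u x = (\<integral>s. indicator {0..x} s * ((f s - c) / A s) \<partial>unit_leb)"
    using du ux by auto
qed

text \<open>Jensen's inequality for the convex function \<open>t \<mapsto> 1/t\<^sup>2\<close>: integrate the tangent at the mean value.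
It replaces the nonlinear functional \<open>1 / (\<integral> b)\<^sup>2\<close> by an average of exponentials of the field.\<close>

lemma inverse_square_integral_le:
  fixes b :: "real \<Rightarrow> real"
  assumes b: "continuous_on {0..1} b" and b0: "\<And>s. s \<in> {0..1} \<Longrightarrow> b s > 0"
  shows "1 / (\<integral>s. b s \<partial>unit_leb)\<^sup>2 \<le> (\<integral>s. 1 / (b s)\<^sup>2 \<partial>unit_leb)"
proof -
  have i: "integrable unit_leb b"
    by (rule integrable_unit_leb[OF b])
  define m where "m = (\<integral>s. b s \<partial>unit_leb)"
  have m: "m > 0"
    unfolding m_def by (rule integral_unit_leb_pos[OF b b0])
  have "1 / m\<^sup>2 = (\<integral>s. 3 / m\<^sup>2 - 2 / m ^ 3 * b s \<partial>unit_leb)"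
    using i m by (simp add: unit_leb.prob_space[simplified] flip: m_def) (simp add: power2_eq_square power3_eq_cube)
  also have "\<dots> \<le> (\<integral>s. 1 / (b s)\<^sup>2 \<partial>unit_leb)"
  proof (rule integral_mono)
    show "integrable unit_leb (\<lambda>s. 1 / (b s)\<^sup>2)"
      by (intro integrable_unit_leb continuous_intros b) (use b0 in force)
    show "3 / m\<^sup>2 - 2 / m ^ 3 * b s \<le> 1 / (b s)\<^sup>2" if "s \<in> space unit_leb" for s
    proof -
      have bs: "b s > 0"
        using b0 that by simp
      \<comment> \<open>With \<open>r = b s / m\<close> the tangent inequality reads \<open>0 \<le> (1 - r)\<^sup>2 (1 + 2 r)\<close>.\<close>
      have "0 \<le> (m - b s)\<^sup>2 * (m + 2 * b s)"
        using bs m by simp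
      then have le: "(3 * m - 2 * b s) * (b s)\<^sup>2 \<le> m ^ 3"
        by (simp add: power2_eq_square power3_eq_cube algebra_simps)
      have eq: "3 / m\<^sup>2 - 2 / m ^ 3 * b s = (3 * m - 2 * b s) / m ^ 3"
        using m by (simp add: power2_eq_square power3_eq_cube field_simps)
      show ?thesis
        unfolding eq using bs m le by (simp add: divide_simps)
    qed
  qed (use i in simp)
  finally show "1 / (\<integral>s. b s \<partial>unit_leb)\<^sup>2 \<le> (\<integral>s. 1 / (b s)\<^sup>2 \<partial>unit_leb)"
    by (simp add: m_def)
qed

text \<open>Both errors are controlled by the fluctuation integrals \<open>Z\<close> of \<open>b - B\<close> against the centred right-hand
side. Subtracting the two explicit solutions gives
\<open>u' - ubar' = (b - B) (f - F) - (c - F) b\<close>, where \<open>F\<close> and \<open>c\<close> are the effective and the random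
flux constants. Since \<open>Z 1 = (c - F) \<integral> b\<close>, and \<open>\<integral> b\<close> over \<open>[0, x]\<close> is at most \<open>\<integral> b\<close> over \<open>[0, 1]\<close>, in the
error of the solution the factor \<open>\<integral> b\<close> cancels. In the error of the derivative the first term cancels
against the corrector and a factor \<open>1 / \<integral> b\<close> remains.\<close>

lemma homogenization_error_pathwise:
  fixes b f u ubar :: "real \<Rightarrow> real" and B :: real
  assumes f: "C1_on01 f" and b: "continuous_on {0..1} b" and b0: "\<And>s. s \<in> {0..1} \<Longrightarrow> b s > 0" and B: "B > 0"
    and u: "dirichlet_solution (\<lambda>s. 1 / b s) f u" and ubar: "dirichlet_solution (\<lambda>s. 1 / B) f ubar"
    and x: "x \<in> {0..1}"
  defines "g \<equiv> (\<lambda>s. f s - (\<integral>t. f t \<partial>unit_leb))"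
  defines "Z \<equiv> (\<lambda>x. \<integral>s. (b s - B) * (indicator {0..x} s * g s) \<partial>unit_leb)"
  shows "(u x - ubar x)\<^sup>2 \<le> 2 * (Z x)\<^sup>2 + 2 * (Z 1)\<^sup>2"
    and "(deriv01 u x - deriv01 ubar x * (b x / B))\<^sup>2 \<le> (b x)\<^sup>2 * (\<integral>s. 1 / (b s)\<^sup>2 \<partial>unit_leb) * (Z 1)\<^sup>2"
proof -
  define F where "F = (\<integral>t. f t \<partial>unit_leb)"
  define m where "m = (\<integral>s. b s \<partial>unit_leb)"
  have b1: "0 \<le> b s" if "0 \<le> s" "s \<le> 1" for s
    using b0[of s] that by simp
  define c where "c = (\<integral>s. f s * b s \<partial>unit_leb) / m"
  have fc: "continuous_on {0..1} f"
    by (rule C1_on01_continuous[OF f])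
  have m: "m > 0"
    unfolding m_def by (rule integral_unit_leb_pos[OF b b0])
  have A1: "continuous_on {0..1} (\<lambda>s. 1 / b s)"
    by (intro continuous_intros b) (use b0 in force)
  note U = dirichlet_solution_flux[OF f A1 _ u]
  have du: "deriv01 u s = (f s - c) * b s" if "s \<in> {0..1}" for s
    using U(1)[OF _ that] b0 by (simp add: c_def m_def)
  have ux: "u x = (\<integral>s. indicator {0..x} s * ((f s - c) * b s) \<partial>unit_leb)"
    using U(2)[OF _ x] b0 by (simp add: c_def m_def)
  note Ub = dirichlet_solution_flux[OF f continuous_on_const _ ubar]
  have dub: "deriv01 ubar s = (f s - F) * B" if "s \<in> {0..1}" for s
    using Ub(1)[OF _ that] B by (simp add: F_def unit_leb.prob_space[simplified])
  have ubx: "ubar x = (\<integral>s. indicator {0..x} s * ((f s - F) * B) \<partial>unit_leb)"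
    using Ub(2)[OF _ x] B by (simp add: F_def unit_leb.prob_space[simplified])
  have ig: "integrable unit_leb (\<lambda>s. indicator {0..y} s * h s)" if "continuous_on {0..1} h" for h :: "real \<Rightarrow> real" and y
    using integrable_mult_indicator[OF _ integrable_unit_leb[OF that], of "{0..y} \<inter> {0..1}"]
    by (rule Bochner_Integration.integrable_cong[THEN iffD1, rotated -1])
      (auto simp: unit_leb_def sets_restrict_space indicator_def)
  have gF: "g = (\<lambda>s. f s - F)"
    by (simp add: g_def F_def)
  have Z1: "Z 1 = m * (c - F)"
  proof -
    have "Z 1 = (\<integral>s. f s * b s - F * b s - B * f s + B * F \<partial>unit_leb)"
      unfolding Z_def gF by (rule Bochner_Integration.integral_cong) (auto simp: algebra_simps)
    also have "\<dots> = (\<integral>s. f s * b s \<partial>unit_leb) - F * m - B * F + B * F"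
      using integrable_unit_leb[OF continuous_on_mult[OF fc b]] integrable_unit_leb[OF fc] integrable_unit_leb[OF b]
      by (simp add: m_def F_def unit_leb.prob_space[simplified])
    also have "\<dots> = m * (c - F)"
      using m by (simp add: c_def field_simps)
    finally show ?thesis .
  qed
  define mx where "mx = (\<integral>s. indicator {0..x} s * b s \<partial>unit_leb)"
  have mx: "0 \<le> mx" "mx \<le> m"
  proof -
    show "0 \<le> mx"
      unfolding mx_def by (rule Bochner_Integration.integral_nonneg) (auto simp: indicator_def b1)
    show "mx \<le> m"
      unfolding mx_def m_def
      by (rule integral_mono[OF ig[OF b] integrable_unit_leb[OF b]]) (auto simp: indicator_def b1)
  qed
  have "u x - ubar x = (\<integral>s. indicator {0..x} s * ((f s - c) * b s) - indicator {0..x} s * ((f s - F) * B) \<partial>unit_leb)"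
    unfolding ux ubx
    by (rule Bochner_Integration.integral_diff[symmetric]) (intro ig continuous_intros fc b)+
  also have "\<dots> = (\<integral>s. indicator {0..x} s * ((b s - B) * (f s - F)) - (c - F) * (indicator {0..x} s * b s) \<partial>unit_leb)"
    by (rule Bochner_Integration.integral_cong) (auto simp: algebra_simps)
  also have "\<dots> = (\<integral>s. indicator {0..x} s * ((b s - B) * (f s - F)) \<partial>unit_leb) - (c - F) * mx"
    unfolding mx_def
    by (subst Bochner_Integration.integral_diff) (intro integrable_mult_right ig continuous_intros fc b | simp)+
  also have "(\<integral>s. indicator {0..x} s * ((b s - B) * (f s - F)) \<partial>unit_leb) = Z x"
    unfolding Z_def gF by (simp add: mult_ac)
  finally have diff: "u x - ubar x = Z x - (c - F) * mx" .
  have "((c - F) * mx)\<^sup>2 \<le> (Z 1)\<^sup>2"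
    unfolding Z1 power_mult_distrib using mx by (subst mult.commute) (intro mult_right_mono power_mono; simp)
  moreover have "(p - q)\<^sup>2 \<le> 2 * p\<^sup>2 + 2 * q\<^sup>2" for p q :: real
    using zero_le_power2[of "p + q"] unfolding power2_sum power2_diff by linarith
  from this[of "Z x" "(c - F) * mx"]
  have "(u x - ubar x)\<^sup>2 \<le> 2 * (Z x)\<^sup>2 + 2 * ((c - F) * mx)\<^sup>2"
    unfolding diff .
  ultimately show "(u x - ubar x)\<^sup>2 \<le> 2 * (Z x)\<^sup>2 + 2 * (Z 1)\<^sup>2"
    by linarith
  have "deriv01 u x - deriv01 ubar x * (b x / B) = - (b x * (c - F))"
    unfolding du[OF x] dub[OF x] using B by (simp add: algebra_simps)
  then have "(deriv01 u x - deriv01 ubar x * (b x / B))\<^sup>2 = (b x)\<^sup>2 * (1 / m\<^sup>2) * (Z 1)\<^sup>2"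
    using m by (simp add: Z1 power_mult_distrib)
  also have "\<dots> \<le> (b x)\<^sup>2 * (\<integral>s. 1 / (b s)\<^sup>2 \<partial>unit_leb) * (Z 1)\<^sup>2"
    unfolding m_def by (intro mult_right_mono mult_left_mono inverse_square_integral_le b b0) auto
  finally show "(deriv01 u x - deriv01 ubar x * (b x / B))\<^sup>2
      \<le> (b x)\<^sup>2 * (\<integral>s. 1 / (b s)\<^sup>2 \<partial>unit_leb) * (Z 1)\<^sup>2" .
qed

section \<open>Second moments of random integrals\<close>

text \<open>Schur's test. Expanding the square and applying Fubini turns the weighted second moment into the
quadratic form of \<^term>\<open>g\<close> with the weighted correlation as its kernel. The inequality
\<open>|g(s) g(t)| \<le> (g(s)\<^sup>2 + g(t)\<^sup>2) / 2\<close> and the symmetry of \<^term>\<open>\<rho>\<close> reduce this form to the row integrals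
of \<^term>\<open>\<rho>\<close>. The uniform bounds \<^term>\<open>D\<close> and \<^term>\<open>B\<close> provide the integrability that Fubini demands.\<close>

lemma second_moment_of_integral_Schur:
  fixes Y :: "'w \<Rightarrow> 's \<Rightarrow> real" and W :: "'w \<Rightarrow> real" and g :: "'s \<Rightarrow> real"
  assumes "prob_space P" "finite_measure U"
    and Y [measurable]: "case_prod Y \<in> borel_measurable (P \<Otimes>\<^sub>M U)"
    and W [measurable]: "W \<in> borel_measurable P" and W0: "\<And>\<omega>. 0 \<le> W \<omega>"
    and int: "\<And>s t. s \<in> space U \<Longrightarrow> t \<in> space U \<Longrightarrow> integrable P (\<lambda>\<omega>. W \<omega> * (Y \<omega> s * Y \<omega> t))"
    and cov: "\<And>s t. s \<in> space U \<Longrightarrow> t \<in> space U \<Longrightarrow> \<bar>\<integral>\<omega>. W \<omega> * (Y \<omega> s * Y \<omega> t) \<partial>P\<bar> \<le> \<rho> s t"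
    and \<rho> [measurable]: "case_prod \<rho> \<in> borel_measurable (U \<Otimes>\<^sub>M U)"
    and sym: "\<And>s t. \<rho> s t = \<rho> t s" and bd: "\<And>s t. s \<in> space U \<Longrightarrow> t \<in> space U \<Longrightarrow> \<rho> s t \<le> D"
    and R: "\<And>s. s \<in> space U \<Longrightarrow> (\<integral>t. \<rho> s t \<partial>U) \<le> R"
    and g [measurable]: "g \<in> borel_measurable U" and gb: "\<And>s. s \<in> space U \<Longrightarrow> \<bar>g s\<bar> \<le> B"
  shows "integrable P (\<lambda>\<omega>. W \<omega> * (\<integral>s. Y \<omega> s * g s \<partial>U)\<^sup>2)"
    and "(\<integral>\<omega>. W \<omega> * (\<integral>s. Y \<omega> s * g s \<partial>U)\<^sup>2 \<partial>P) \<le> R * (\<integral>s. (g s)\<^sup>2 \<partial>U)"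
proof -
  interpret P: prob_space P by fact
  interpret U: finite_measure U by fact
  interpret UU: pair_sigma_finite U U ..
  interpret UUf: finite_measure "U \<Otimes>\<^sub>M U"
    by (rule finite_measure_pair_measure) unfold_locales
  interpret Q: pair_sigma_finite "U \<Otimes>\<^sub>M U" P ..
  interpret Q': pair_sigma_finite P "U \<Otimes>\<^sub>M U" ..
  define F where "F = (\<lambda>\<omega> (s, t). W \<omega> * (Y \<omega> s * Y \<omega> t) * (g s * g t))"
  have F [measurable]: "(\<lambda>(\<omega>, z). F \<omega> z) \<in> borel_measurable (P \<Otimes>\<^sub>M (U \<Otimes>\<^sub>M U))"
    unfolding F_def by measurable
  have F' [measurable]: "(\<lambda>(z, \<omega>). F \<omega> z) \<in> borel_measurable ((U \<Otimes>\<^sub>M U) \<Otimes>\<^sub>M P)"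
    by measurable
  have \<rho>0: "0 \<le> \<rho> s t" if "s \<in> space U" "t \<in> space U" for s t
    using cov[OF that] by linarith
  have g2: "(g s)\<^sup>2 \<le> B\<^sup>2" if "s \<in> space U" for s
    using gb[OF that] by (metis abs_le_square_iff abs_of_nonneg abs_ge_zero order_trans)
  have absbd: "(\<integral>\<omega>. \<bar>F \<omega> (s, t)\<bar> \<partial>P) \<le> D * B\<^sup>2" and Fint: "integrable P (\<lambda>\<omega>. F \<omega> (s, t))"
    if st: "s \<in> space U" "t \<in> space U" for s t
  proof -
    show "integrable P (\<lambda>\<omega>. F \<omega> (s, t))"
      unfolding F_def using int[OF st] by simp
    have "(\<integral>\<omega>. \<bar>W \<omega> * (Y \<omega> s * Y \<omega> t)\<bar> \<partial>P)
        \<le> (\<integral>\<omega>. (W \<omega> * (Y \<omega> s * Y \<omega> s) + W \<omega> * (Y \<omega> t * Y \<omega> t)) / 2 \<partial>P)"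
    proof (rule integral_mono)
      show "\<bar>W \<omega> * (Y \<omega> s * Y \<omega> t)\<bar> \<le> (W \<omega> * (Y \<omega> s * Y \<omega> s) + W \<omega> * (Y \<omega> t * Y \<omega> t)) / 2" for \<omega>
        using mult_left_mono[OF abs_mult_le_half_sum_squares[of "Y \<omega> s" "Y \<omega> t"] W0[of \<omega>]] W0[of \<omega>]
        by (simp add: abs_mult power2_eq_square algebra_simps add_divide_distrib)
    qed (use int st in auto)
    also have "\<dots> = ((\<integral>\<omega>. W \<omega> * (Y \<omega> s * Y \<omega> s) \<partial>P) + (\<integral>\<omega>. W \<omega> * (Y \<omega> t * Y \<omega> t) \<partial>P)) / 2"
      using int st by simp
    also have "\<dots> \<le> D"
    proof -
      have "(\<integral>\<omega>. W \<omega> * (Y \<omega> r * Y \<omega> r) \<partial>P) \<le> D" if "r \<in> space U" for r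
        using cov[OF that that] bd[OF that that] by (simp add: abs_le_iff)
      from this[OF st(1)] this[OF st(2)] show ?thesis
        by simp
    qed
    finally have E: "(\<integral>\<omega>. \<bar>W \<omega> * (Y \<omega> s * Y \<omega> t)\<bar> \<partial>P) \<le> D" .
    have "(\<integral>\<omega>. \<bar>F \<omega> (s, t)\<bar> \<partial>P) = \<bar>g s * g t\<bar> * (\<integral>\<omega>. \<bar>W \<omega> * (Y \<omega> s * Y \<omega> t)\<bar> \<partial>P)"
      unfolding F_def
      by (subst integral_mult_right_zero[symmetric], rule Bochner_Integration.integral_cong) (auto simp: abs_mult mult_ac)
    also have "\<dots> \<le> \<bar>g s * g t\<bar> * D"
      using E by (rule mult_left_mono) simp
    also have "\<bar>g s * g t\<bar> * D \<le> B\<^sup>2 * D"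
    proof (rule mult_right_mono)
      show "\<bar>g s * g t\<bar> \<le> B\<^sup>2"
        unfolding abs_mult power2_eq_square using gb st by (intro mult_mono) (auto intro: order_trans[OF abs_ge_zero])
      show "0 \<le> D"
        using \<rho>0[OF st] bd[OF st] by linarith
    qed
    finally show "(\<integral>\<omega>. \<bar>F \<omega> (s, t)\<bar> \<partial>P) \<le> D * B\<^sup>2"
      by (simp add: mult.commute)
  qed
  have intQ: "integrable ((U \<Otimes>\<^sub>M U) \<Otimes>\<^sub>M P) (\<lambda>(z, \<omega>). F \<omega> z)"
  proof (rule Q.Fubini_integrable)
    show "integrable (U \<Otimes>\<^sub>M U) (\<lambda>z. \<integral>\<omega>. norm (case (z, \<omega>) of (z, \<omega>) \<Rightarrow> F \<omega> z) \<partial>P)"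
      by (rule UUf.integrable_const_bound[of _ "D * B\<^sup>2"])
        (auto simp: space_pair_measure intro!: AE_I2 absbd)
  qed (auto simp: space_pair_measure intro!: AE_I2 Fint)
  have intQ': "integrable (P \<Otimes>\<^sub>M (U \<Otimes>\<^sub>M U)) (\<lambda>(\<omega>, z). F \<omega> z)"
    using Q.integrable_product_swap[OF intQ] by simp
  \<comment> \<open>For almost every outcome, Fubini on the square factorizes the double integral.\<close>
  have path: "AE \<omega> in P. (\<integral>z. F \<omega> z \<partial>(U \<Otimes>\<^sub>M U)) = W \<omega> * (\<integral>s. Y \<omega> s * g s \<partial>U)\<^sup>2"
    using Q'.AE_integrable_fst'[OF intQ']
  proof eventually_elim
    case (elim \<omega>)
    then have "(\<integral>z. F \<omega> z \<partial>(U \<Otimes>\<^sub>M U)) = (\<integral>s. (\<integral>t. F \<omega> (s, t) \<partial>U) \<partial>U)"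
      using UU.integral_fst'[of "F \<omega>"] by simp
    also have "\<dots> = (\<integral>s. (W \<omega> * (Y \<omega> s * g s)) * (\<integral>t. Y \<omega> t * g t \<partial>U) \<partial>U)"
      unfolding F_def
      by (intro Bochner_Integration.integral_cong refl, subst integral_mult_right_zero[symmetric])
        (auto intro!: Bochner_Integration.integral_cong simp: mult_ac)
    also have "\<dots> = W \<omega> * (\<integral>s. Y \<omega> s * g s \<partial>U)\<^sup>2"
      by (simp only: integral_mult_left_zero integral_mult_right_zero) (simp add: power2_eq_square)
    finally show ?case .
  qed
  have Fst: "integrable P (\<lambda>\<omega>. \<integral>z. F \<omega> z \<partial>(U \<Otimes>\<^sub>M U))"
    using Q'.integrable_fst'[OF intQ'] by simp
  have meas [measurable]: "(\<lambda>\<omega>. W \<omega> * (\<integral>s. Y \<omega> s * g s \<partial>U)\<^sup>2) \<in> borel_measurable P"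
    by measurable
  show "integrable P (\<lambda>\<omega>. W \<omega> * (\<integral>s. Y \<omega> s * g s \<partial>U)\<^sup>2)"
    using integrable_cong_AE[OF _ meas path] Fst by auto
  have "(\<integral>\<omega>. W \<omega> * (\<integral>s. Y \<omega> s * g s \<partial>U)\<^sup>2 \<partial>P) = (\<integral>\<omega>. (\<integral>z. F \<omega> z \<partial>(U \<Otimes>\<^sub>M U)) \<partial>P)"
    using integral_cong_AE[OF _ meas path] Fst by auto
  also have "\<dots> = (\<integral>z. (\<integral>\<omega>. F \<omega> z \<partial>P) \<partial>(U \<Otimes>\<^sub>M U))"
    using Q.Fubini_integral[OF intQ] by simp
  also have "\<dots> \<le> (\<integral>z. (\<lambda>(s, t). \<rho> s t * (g s)\<^sup>2 / 2 + \<rho> t s * (g t)\<^sup>2 / 2) z \<partial>(U \<Otimes>\<^sub>M U))"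
  proof (rule integral_mono)
    show "integrable (U \<Otimes>\<^sub>M U) (\<lambda>z. \<integral>\<omega>. F \<omega> z \<partial>P)"
      using Q.integrable_fst'[OF intQ] by simp
    have "\<bar>\<rho> s t * (g s)\<^sup>2 / 2 + \<rho> t s * (g t)\<^sup>2 / 2\<bar> \<le> D * B\<^sup>2"
      if st: "s \<in> space U" "t \<in> space U" for s t
    proof -
      have "\<rho> s t * (g s)\<^sup>2 \<le> D * B\<^sup>2" "\<rho> t s * (g t)\<^sup>2 \<le> D * B\<^sup>2"
        using st g2 bd \<rho>0 by (auto intro!: mult_mono intro: order_trans[OF \<rho>0])
      moreover have "0 \<le> \<rho> s t * (g s)\<^sup>2" "0 \<le> \<rho> t s * (g t)\<^sup>2"
        using st \<rho>0 by auto
      ultimately show ?thesis by linarith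
    qed
    then show "integrable (U \<Otimes>\<^sub>M U) (\<lambda>(s, t). \<rho> s t * (g s)\<^sup>2 / 2 + \<rho> t s * (g t)\<^sup>2 / 2)"
      by (intro UUf.integrable_const_bound[of _ "D * B\<^sup>2"]) (auto simp: space_pair_measure intro!: AE_I2)
    fix z assume "z \<in> space (U \<Otimes>\<^sub>M U)"
    then obtain s t where z: "z = (s, t)" and st: "s \<in> space U" "t \<in> space U"
      by (auto simp: space_pair_measure)
    have "(\<integral>\<omega>. F \<omega> (s, t) \<partial>P) = (\<integral>\<omega>. W \<omega> * (Y \<omega> s * Y \<omega> t) \<partial>P) * (g s * g t)"
      unfolding F_def by simp
    also have "\<dots> \<le> \<bar>\<integral>\<omega>. W \<omega> * (Y \<omega> s * Y \<omega> t) \<partial>P\<bar> * \<bar>g s * g t\<bar>"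
      by (metis abs_ge_self abs_mult)
    also have "\<dots> \<le> \<rho> s t * (((g s)\<^sup>2 + (g t)\<^sup>2) / 2)"
      by (intro mult_mono cov st abs_mult_le_half_sum_squares \<rho>0) auto
    finally show "(\<integral>\<omega>. F \<omega> z \<partial>P) \<le> (\<lambda>(s, t). \<rho> s t * (g s)\<^sup>2 / 2 + \<rho> t s * (g t)\<^sup>2 / 2) z"
      by (simp add: z sym[of t s] algebra_simps add_divide_distrib)
  qed
  also have "\<dots> = (\<integral>s. (\<integral>t. \<rho> s t \<partial>U) * (g s)\<^sup>2 \<partial>U)"
  proof -
    have "\<bar>\<rho> s t * (g s)\<^sup>2 / 2\<bar> \<le> D * B\<^sup>2" "\<bar>\<rho> t s * (g t)\<^sup>2 / 2\<bar> \<le> D * B\<^sup>2"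
      if st: "s \<in> space U" "t \<in> space U" for s t
    proof -
      have "\<rho> s t * (g s)\<^sup>2 \<le> D * B\<^sup>2" "\<rho> t s * (g t)\<^sup>2 \<le> D * B\<^sup>2"
        using st g2 bd \<rho>0 by (auto intro!: mult_mono intro: order_trans[OF \<rho>0])
      moreover have "0 \<le> \<rho> s t * (g s)\<^sup>2" "0 \<le> \<rho> t s * (g t)\<^sup>2"
        using st \<rho>0 by auto
      ultimately show "\<bar>\<rho> s t * (g s)\<^sup>2 / 2\<bar> \<le> D * B\<^sup>2" "\<bar>\<rho> t s * (g t)\<^sup>2 / 2\<bar> \<le> D * B\<^sup>2"
        by linarith+
    qed
    then have i: "integrable (U \<Otimes>\<^sub>M U) (\<lambda>(s, t). \<rho> s t * (g s)\<^sup>2 / 2)"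
        "integrable (U \<Otimes>\<^sub>M U) (\<lambda>(s, t). \<rho> t s * (g t)\<^sup>2 / 2)"
      by (intro UUf.integrable_const_bound[of _ "D * B\<^sup>2"]; force simp: space_pair_measure intro!: AE_I2)+
    have "(\<integral>z. (\<lambda>(s, t). \<rho> s t * (g s)\<^sup>2 / 2 + \<rho> t s * (g t)\<^sup>2 / 2) z \<partial>(U \<Otimes>\<^sub>M U))
      = (\<integral>z. (\<lambda>(s, t). \<rho> s t * (g s)\<^sup>2 / 2) z \<partial>(U \<Otimes>\<^sub>M U)) + (\<integral>z. (\<lambda>(s, t). \<rho> t s * (g t)\<^sup>2 / 2) z \<partial>(U \<Otimes>\<^sub>M U))"
      using Bochner_Integration.integral_add[OF i] by (simp only: split_beta')
    also have "(\<integral>z. (\<lambda>(s, t). \<rho> t s * (g t)\<^sup>2 / 2) z \<partial>(U \<Otimes>\<^sub>M U)) = (\<integral>z. (\<lambda>(s, t). \<rho> s t * (g s)\<^sup>2 / 2) z \<partial>(U \<Otimes>\<^sub>M U))"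
      using UU.integral_product_swap[of "\<lambda>(s, t). \<rho> s t * (g s)\<^sup>2 / 2"] i(1) by auto
    also have "(\<integral>z. (\<lambda>(s, t). \<rho> s t * (g s)\<^sup>2 / 2) z \<partial>(U \<Otimes>\<^sub>M U)) = (\<integral>s. (\<integral>t. \<rho> s t * (g s)\<^sup>2 / 2 \<partial>U) \<partial>U)"
      using UU.integral_fst'[OF i(1)] by simp
    finally show ?thesis
      by simp
  qed
  also have "\<dots> \<le> (\<integral>s. R * (g s)\<^sup>2 \<partial>U)"
  proof (rule integral_mono')
    show "integrable U (\<lambda>s. R * (g s)\<^sup>2)"
      by (intro integrable_mult_right U.integrable_const_bound[of _ "B\<^sup>2"]) (auto intro!: AE_I2 g2)
    have "0 \<le> R" if "s \<in> space U" for s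
    proof -
      have "0 \<le> (\<integral>t. \<rho> s t \<partial>U)"
        using that \<rho>0 by (intro integral_nonneg_AE AE_I2)
      then show ?thesis
        using R[OF that] by linarith
    qed
    then show "0 \<le> R * (g s)\<^sup>2" if "s \<in> space U" for s
      using that by simp
    show "(\<integral>t. \<rho> s t \<partial>U) * (g s)\<^sup>2 \<le> R * (g s)\<^sup>2" if "s \<in> space U" for s
      using R[OF that] by (intro mult_right_mono) auto
  qed
  finally show "(\<integral>\<omega>. W \<omega> * (\<integral>s. Y \<omega> s * g s \<partial>U)\<^sup>2 \<partial>P) \<le> R * (\<integral>s. (g s)\<^sup>2 \<partial>U)"
    by simp
qed

text \<open>The three regimes of the rate come from here: up to a constant, the square of the rate bounds the
mean over the unit interval of the correlation \<open>(1 + |x - t| / \<epsilon>) powr (- \<beta>)\<close>. The kernel has an explicit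
primitive, whose growth at infinity is a power, a logarithm, or bounded according to whether
\<^term>\<open>\<beta>\<close> is less than, equal to, or greater than one.\<close>

lemma integral_power_kernel_le_rate:
  assumes "\<beta> > 0"
  obtains c where "c > 0"
    and "\<And>\<epsilon> x. 0 < \<epsilon> \<Longrightarrow> \<epsilon> \<le> 1/2 \<Longrightarrow> x \<in> {0..1} \<Longrightarrow>
      (\<integral>t. (1 + \<bar>(x - t) / \<epsilon>\<bar>) powr (- \<beta>) \<partial>unit_leb) \<le> c * (rate \<beta> \<epsilon>)\<^sup>2"
proof -
  \<comment> \<open>The primitive in the distance to the centre of the kernel, vanishing at distance zero.\<close>
  define \<Phi> where "\<Phi> = (\<lambda>\<epsilon> r::real. if \<beta> = 1 then \<epsilon> * ln (1 + r / \<epsilon>)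
    else \<epsilon> * ((1 + r / \<epsilon>) powr (1 - \<beta>) - 1) / (1 - \<beta>))"
  define c where "c = (if \<beta> = 1 then 4 else 2 * 2 powr \<bar>1 - \<beta>\<bar> / \<bar>1 - \<beta>\<bar>)"
  have deriv: "(\<Phi> \<epsilon> has_real_derivative (1 + r / \<epsilon>) powr (- \<beta>)) (at r)" if "0 < \<epsilon>" "0 \<le> r" for \<epsilon> r
  proof -
    have pos: "1 + r / \<epsilon> > 0"
      using that by (simp add: add_pos_nonneg)
    show ?thesis
    proof (cases "\<beta> = 1")
      case True
      show ?thesis
        unfolding \<Phi>_def using True pos that
        by (auto intro!: derivative_eq_intros simp: powr_minus divide_simps)
    next
      case False
      show ?thesis
        unfolding \<Phi>_def using False pos that
        by (auto intro!: derivative_eq_intros simp: divide_simps)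
    qed
  qed
  have \<Phi>0: "\<Phi> \<epsilon> 0 = 0" for \<epsilon>
    by (simp add: \<Phi>_def)
  have mono: "\<Phi> \<epsilon> r \<le> \<Phi> \<epsilon> 1" if "0 < \<epsilon>" "0 \<le> r" "r \<le> 1" for \<epsilon> r
  proof (rule DERIV_nonneg_imp_nondecreasing[OF that(3)])
    show "\<exists>y. (\<Phi> \<epsilon> has_real_derivative y) (at z) \<and> 0 \<le> y" if "r \<le> z" "z \<le> 1" for z
      using deriv[of \<epsilon> z] \<open>0 < \<epsilon>\<close> \<open>0 \<le> r\<close> that by (auto intro!: exI)
  qed
  have bound: "2 * \<Phi> \<epsilon> 1 \<le> c * (rate \<beta> \<epsilon>)\<^sup>2" if \<epsilon>: "0 < \<epsilon>" "\<epsilon> \<le> 1/2" for \<epsilon>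
  proof -
    consider "\<beta> < 1" | "\<beta> = 1" | "\<beta> > 1" by linarith
    then show ?thesis
    proof cases
      case 1
      have r: "(rate \<beta> \<epsilon>)\<^sup>2 = \<epsilon> powr \<beta>"
        using 1 \<epsilon> by (simp add: rate_def power2_eq_square flip: powr_add)
      have "\<epsilon> * (1 + 1 / \<epsilon>) powr (1 - \<beta>) \<le> \<epsilon> * (2 / \<epsilon>) powr (1 - \<beta>)"
        using 1 \<epsilon> by (intro mult_left_mono powr_mono2) (auto simp: field_simps)
      also have "\<dots> = 2 powr (1 - \<beta>) * \<epsilon> powr \<beta>"
        using \<epsilon> by (simp add: powr_divide powr_diff)
      finally have "\<epsilon> * ((1 + 1 / \<epsilon>) powr (1 - \<beta>) - 1) \<le> 2 powr (1 - \<beta>) * \<epsilon> powr \<beta>"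
        using \<epsilon> by (simp add: algebra_simps)
      then show ?thesis
        using 1 \<epsilon> unfolding r \<Phi>_def c_def by (simp add: divide_right_mono)
    next
      case 2
      have r: "(rate \<beta> \<epsilon>)\<^sup>2 = \<epsilon> * \<bar>ln \<epsilon>\<bar>"
        using 2 \<epsilon> by (simp add: rate_def power_mult_distrib powr_half_sqrt)
      \<comment> \<open>The bound on the scale gives \<open>1 + 1/\<epsilon> \<le> 1/\<epsilon>\<^sup>2\<close>, so the logarithm costs only a factor two.\<close>
      have "\<epsilon> * \<epsilon> \<le> 1/2 * (1/2)"
        using \<epsilon> by (intro mult_mono) auto
      then have "(\<epsilon> + 1) * \<epsilon> \<le> 1"
        using \<epsilon> by (simp add: distrib_right)
      then have "1 + 1 / \<epsilon> \<le> (1 / \<epsilon>)\<^sup>2"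
        using \<epsilon> by (simp add: divide_simps power2_eq_square)
      then have "ln (1 + 1 / \<epsilon>) \<le> ln ((1 / \<epsilon>)\<^sup>2)"
        using \<epsilon> by (subst ln_le_cancel_iff) (auto intro: add_pos_pos)
      also have "\<dots> = 2 * \<bar>ln \<epsilon>\<bar>"
        using \<epsilon> by (simp add: ln_realpow ln_div)
      finally have "\<epsilon> * ln (1 + 1 / \<epsilon>) \<le> \<epsilon> * (2 * \<bar>ln \<epsilon>\<bar>)"
        using \<epsilon> by (intro mult_left_mono) auto
      then show ?thesis
        using 2 unfolding r \<Phi>_def c_def by simp
    next
      case 3
      have r: "(rate \<beta> \<epsilon>)\<^sup>2 = \<epsilon>"
        using 3 \<epsilon> by (simp add: rate_def)
      have "\<Phi> \<epsilon> 1 = \<epsilon> * (1 - (1 + 1 / \<epsilon>) powr (1 - \<beta>)) / (\<beta> - 1)"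
      proof -
        have "e * (p - 1) / (1 - \<beta>) = e * (1 - p) / (\<beta> - 1)" for e p :: real
          using 3 by (simp add: divide_simps) (simp add: algebra_simps)
        then show ?thesis
          using 3 by (simp add: \<Phi>_def)
      qed
      also have "\<dots> \<le> \<epsilon> * 1 / (\<beta> - 1)"
        using 3 \<epsilon> by (intro divide_right_mono mult_left_mono) auto
      also have "\<dots> \<le> \<epsilon> * 2 powr (\<beta> - 1) / (\<beta> - 1)"
        using 3 \<epsilon> by (intro divide_right_mono mult_left_mono ge_one_powr_ge_zero) auto
      finally show ?thesis
        using 3 \<epsilon> unfolding r c_def by (simp add: field_simps)
    qed
  qed
  show ?thesis
  proof (rule that)
    show "c > 0"
      by (simp add: c_def)
    fix \<epsilon> x :: real assume \<epsilon>: "0 < \<epsilon>" "\<epsilon> \<le> 1/2" and x: "x \<in> {0..1}"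
    let ?k = "\<lambda>t. (1 + \<bar>(x - t) / \<epsilon>\<bar>) powr (- \<beta>)"
    have cont: "continuous_on {0..1} ?k"
      using \<epsilon> by (intro continuous_intros) (auto simp: add_pos_nonneg add_nonneg_eq_0_iff)
    have "(?k has_integral (- \<Phi> \<epsilon> (x - x) - (- \<Phi> \<epsilon> (x - 0)))) {0..x}"
    proof (rule fundamental_theorem_of_calculus)
      fix t assume t: "t \<in> {0..x}"
      have "((\<lambda>t. - \<Phi> \<epsilon> (x - t)) has_real_derivative - ((1 + (x - t) / \<epsilon>) powr (- \<beta>) * (- 1))) (at t)"
        using t \<epsilon> by (intro DERIV_minus DERIV_chain2[where f = "\<Phi> \<epsilon>" and g = "\<lambda>t. x - t"] deriv)
          (auto intro!: derivative_eq_intros)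
      then show "((\<lambda>t. - \<Phi> \<epsilon> (x - t)) has_vector_derivative ?k t) (at t within {0..x})"
        using t \<epsilon> by (simp add: has_real_derivative_iff_has_vector_derivative has_vector_derivative_at_within)
    qed (use x in auto)
    moreover have "(?k has_integral (\<Phi> \<epsilon> (1 - x) - \<Phi> \<epsilon> (x - x))) {x..1}"
    proof (rule fundamental_theorem_of_calculus)
      fix t assume t: "t \<in> {x..1}"
      have "((\<lambda>t. \<Phi> \<epsilon> (t - x)) has_real_derivative (1 + (t - x) / \<epsilon>) powr (- \<beta>) * 1) (at t)"
        using t \<epsilon> by (intro DERIV_chain2[where f = "\<Phi> \<epsilon>" and g = "\<lambda>t. t - x"] deriv)
          (auto intro!: derivative_eq_intros)
      then show "((\<lambda>t. \<Phi> \<epsilon> (t - x)) has_vector_derivative ?k t) (at t within {x..1})"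
        using t \<epsilon> by (simp add: has_real_derivative_iff_has_vector_derivative has_vector_derivative_at_within abs_minus_commute)
    qed (use x in auto)
    ultimately have "(?k has_integral (\<Phi> \<epsilon> x + \<Phi> \<epsilon> (1 - x))) {0..1}"
      using has_integral_combine[of 0 x 1 ?k "\<Phi> \<epsilon> x" "\<Phi> \<epsilon> (1 - x)"] x by (simp add: \<Phi>0)
    then have "(\<integral>t. ?k t \<partial>unit_leb) = \<Phi> \<epsilon> x + \<Phi> \<epsilon> (1 - x)"
      using set_borel_integral_eq_integral(2)[OF borel_integrable_atLeastAtMost'[OF cont]]
      by (simp add: integral_unit_leb set_lebesgue_integral_def integral_unique)
    also have "\<dots> \<le> 2 * \<Phi> \<epsilon> 1"
      using mono[of \<epsilon> x] mono[of \<epsilon> "1 - x"] x \<epsilon> by simp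
    also have "\<dots> \<le> c * (rate \<beta> \<epsilon>)\<^sup>2"
      by (rule bound[OF \<epsilon>])
    finally show "(\<integral>t. ?k t \<partial>unit_leb) \<le> c * (rate \<beta> \<epsilon>)\<^sup>2" .
  qed
qed

section \<open>Covariances under exponential weights\<close>

lemma abs_exp_minus_one_le:
  fixes z :: real
  shows "\<bar>exp z - 1\<bar> \<le> \<bar>z\<bar> * exp \<bar>z\<bar>"
proof (cases "z \<ge> 0")
  case True
  have "(1 - z) * exp z \<le> exp (- z) * exp z"
    using exp_ge_add_one_self[of "- z"] by (intro mult_right_mono) auto
  then show ?thesis
    using True by (simp add: algebra_simps flip: exp_add)
next
  case False
  have "1 - exp z \<le> - z * 1"
    using exp_ge_add_one_self[of z] by linarith
  also have "\<dots> \<le> - z * exp (- z)"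
    using False by (intro mult_left_mono) auto
  finally show ?thesis
    using False by simp
qed

lemma power_kernel_le_one:
  fixes z :: real
  assumes "\<beta> > 0"
  shows "(1 + \<bar>z\<bar>) powr (- \<beta>) \<le> 1"
proof -
  have "1 + \<bar>z\<bar> \<noteq> 0" "1 \<le> 1 + \<bar>z\<bar>"
    by auto
  then show ?thesis
    using powr_mono[of "- \<beta>" 0 "1 + \<bar>z\<bar>"] assms by (simp only: powr_zero_eq_one) simp
qed

context
  fixes P :: "'w measure" and G :: "real \<Rightarrow> 'w \<Rightarrow> real" and C :: "real \<Rightarrow> real"
  assumes P: "prob_space P" and G: "stationary_centered_gaussian_field P G C"
begin

lemma covariance_even: "C (- z) = C z"
proof -
  have cov: "\<And>x y. (\<integral>\<omega>. G x \<omega> * G y \<omega> \<partial>P) = C (x - y)"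
    using G by (simp add: stationary_centered_gaussian_field_def)
  show ?thesis
    using cov[of 0 z] cov[of z 0] by (simp add: mult.commute)
qed

lemma four_point_exponential_moment:
  shows "integrable P (\<lambda>\<omega>. exp (2 * G y \<omega> - 2 * G x \<omega> - c * G s \<omega> - d * G t \<omega>))" (is ?i)
    and "(\<integral>\<omega>. exp (2 * G y \<omega> - 2 * G x \<omega> - c * G s \<omega> - d * G t \<omega>) \<partial>P)
      = exp (4 * C 0 - 4 * C (x - y) + (c\<^sup>2 + d\<^sup>2) * C 0 / 2 + c * d * C (s - t)
          - c * (2 * C (y - s) - 2 * C (x - s)) - d * (2 * C (y - t) - 2 * C (x - t)))" (is ?e)
proof -
  define p where "p = (\<lambda>i::nat. [y, x, s, t] ! i)"
  define k where "k = (\<lambda>i::nat. [2, - 2, - c, - d] ! i)"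
  have S: "(\<Sum>i<4. f i) = f 0 + f 1 + f 2 + f 3" for f :: "nat \<Rightarrow> real"
    by (simp add: eval_nat_numeral)
  have X: "(\<Sum>i<4. k i * G (p i) \<omega>) = 2 * G y \<omega> - 2 * G x \<omega> - c * G s \<omega> - d * G t \<omega>" for \<omega>
    unfolding S by (simp add: k_def p_def numeral_2_eq_2 numeral_3_eq_3)
  have V: "(\<Sum>i<4. \<Sum>j<4. k i * k j * C (p i - p j)) / 2
    = 4 * C 0 - 4 * C (x - y) + (c\<^sup>2 + d\<^sup>2) * C 0 / 2 + c * d * C (s - t)
          - c * (2 * C (y - s) - 2 * C (x - s)) - d * (2 * C (y - t) - 2 * C (x - t))"
    using covariance_even[of "x - y"] covariance_even[of "s - t"] covariance_even[of "y - s"]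
      covariance_even[of "x - s"] covariance_even[of "y - t"] covariance_even[of "x - t"]
    unfolding S by (simp add: k_def p_def numeral_2_eq_2 numeral_3_eq_3 power2_eq_square field_simps)
  show ?i ?e
    using gaussian_field_exponential_moment[OF P G, of "{..<4::nat}" k p] unfolding X V by simp_all
qed

text \<open>The weight is the exponential of a Gaussian variable, so it acts as a change of measure: it shifts
the mean of the field at \<^term>\<open>s\<close> by \<^term>\<open>h x y s\<close> and preserves covariances. The two summands in the bracket are
the covariance of the shifted exponentials and the product of their two biases.\<close>

lemma tilted_covariance:
  defines "B \<equiv> exp (C 0 / 2)" and "h \<equiv> (\<lambda>x y s. 2 * C (y - s) - 2 * C (x - s))"
  shows "integrable P (\<lambda>\<omega>. exp (2 * G y \<omega> - 2 * G x \<omega>) * ((exp (- G s \<omega>) - B) * (exp (- G t \<omega>) - B)))" (is ?i)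
    and "(\<integral>\<omega>. exp (2 * G y \<omega> - 2 * G x \<omega>) * ((exp (- G s \<omega>) - B) * (exp (- G t \<omega>) - B)) \<partial>P)
      = exp (4 * C 0 - 4 * C (x - y)) * B\<^sup>2 *
        (exp (- h x y s) * exp (- h x y t) * (exp (C (s - t)) - 1) + (exp (- h x y s) - 1) * (exp (- h x y t) - 1))" (is ?e)
proof -
  define E where "E = (\<lambda>c d \<omega>. exp (2 * G y \<omega> - 2 * G x \<omega> - c * G s \<omega> - d * G t \<omega>))"
  note I = four_point_exponential_moment(1)[of y x _ s _ t, folded E_def]
  note EE = four_point_exponential_moment(2)[of y x _ s _ t, folded E_def]
  \<comment> \<open>Expanding the product leaves four pure exponential moments.\<close>
  have split: "exp (2 * G y \<omega> - 2 * G x \<omega>) * ((exp (- G s \<omega>) - B) * (exp (- G t \<omega>) - B))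
    = E 1 1 \<omega> - B * E 1 0 \<omega> - B * E 0 1 \<omega> + B\<^sup>2 * E 0 0 \<omega>" for \<omega>
  proof -
    define w p q where "w = exp (2 * G y \<omega> - 2 * G x \<omega>)" and "p = exp (- G s \<omega>)" and "q = exp (- G t \<omega>)"
    have "E 1 1 \<omega> = w * p * q" "E 1 0 \<omega> = w * p" "E 0 1 \<omega> = w * q" "E 0 0 \<omega> = w"
      by (simp_all add: E_def w_def p_def q_def flip: exp_add)
    then show ?thesis
      unfolding w_def[symmetric] p_def[symmetric] q_def[symmetric]
      by (simp add: algebra_simps power2_eq_square)
  qed
  have int: "integrable P (E c d)" for c d
    using I[of c d] by (simp add: E_def)
  show ?i
    unfolding split using int by simp
  have BB: "exp (C 0) = B\<^sup>2"
    by (simp add: B_def power2_eq_square flip: exp_add)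
  define w where "w = exp (4 * C 0 - 4 * C (x - y))"
  have E11: "integral\<^sup>L P (E 1 1) = w * B\<^sup>2 * exp (C (s - t)) * exp (- h x y s) * exp (- h x y t)"
    using EE[of 1 1] by (simp add: E_def w_def h_def flip: BB exp_add)
  have E10: "integral\<^sup>L P (E 1 0) = w * B * exp (- h x y s)"
    using EE[of 1 0] by (simp add: E_def w_def h_def B_def flip: exp_add)
  have E01: "integral\<^sup>L P (E 0 1) = w * B * exp (- h x y t)"
    using EE[of 0 1] by (simp add: E_def w_def h_def B_def flip: exp_add)
  have E00: "integral\<^sup>L P (E 0 0) = w"
    using EE[of 0 0] by (simp add: E_def w_def)
  show ?e
    unfolding split w_def[symmetric] using int
    by (simp add: E11 E10 E01 E00) (simp add: algebra_simps power2_eq_square)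
qed

text \<open>Each factor \<open>exp z - 1\<close> inherits the decay of \<^term>\<open>C\<close>. The covariance term decays in the distance of
\<^term>\<open>s\<close> and \<^term>\<open>t\<close>, the bias term in the distances of \<^term>\<open>s\<close> and \<^term>\<open>t\<close> from the two tilting points.
Half of the exponent \<open>18 K\<close> bounds the prefactor and half the exponentials in the bracket.\<close>

lemma tilted_covariance_le:
  assumes decay: "\<And>z. \<bar>C z\<bar> \<le> K * (1 + \<bar>z\<bar>) powr (- \<beta>)" and \<beta>: "\<beta> > 0"
  defines "\<kappa> \<equiv> (\<lambda>z::real. (1 + \<bar>z\<bar>) powr (- \<beta>))"
  shows "\<bar>\<integral>\<omega>. exp (2 * G y \<omega> - 2 * G x \<omega>) *
        ((exp (- G s \<omega>) - exp (C 0 / 2)) * (exp (- G t \<omega>) - exp (C 0 / 2))) \<partial>P\<bar>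
    \<le> exp (18 * K) * (K + 4 * K\<^sup>2) * (\<kappa> (s - t) + (\<kappa> (x - s) + \<kappa> (y - s)) * (\<kappa> (x - t) + \<kappa> (y - t)))"
proof -
  have \<kappa>: "0 \<le> \<kappa> z" "\<kappa> z \<le> 1" for z
    unfolding \<kappa>_def by (auto intro: power_kernel_le_one \<beta>)
  have K0: "0 \<le> K"
    using decay[of 0] by simp
  have C\<kappa>: "\<bar>C z\<bar> \<le> K * \<kappa> z" for z
    using decay by (simp add: \<kappa>_def)
  have CK: "\<bar>C z\<bar> \<le> K" for z
    using C\<kappa>[of z] mult_left_mono[OF \<kappa>(2)[of z] K0] by simp
  define h where "h = (\<lambda>s. 2 * C (y - s) - 2 * C (x - s))"
  have hK: "\<bar>h s\<bar> \<le> 4 * K" for s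
    unfolding h_def using CK[of "y - s"] CK[of "x - s"] by linarith
  have h\<kappa>: "\<bar>h s\<bar> \<le> 2 * K * (\<kappa> (x - s) + \<kappa> (y - s))" for s
    unfolding h_def distrib_left using C\<kappa>[of "y - s"] C\<kappa>[of "x - s"] by linarith
  have eh: "\<bar>exp (- h s) - 1\<bar> \<le> 2 * K * (\<kappa> (x - s) + \<kappa> (y - s)) * exp (4 * K)" for s
  proof -
    have "\<bar>exp (- h s) - 1\<bar> \<le> \<bar>h s\<bar> * exp \<bar>h s\<bar>"
      using abs_exp_minus_one_le[of "- h s"] by simp
    also have "\<dots> \<le> 2 * K * (\<kappa> (x - s) + \<kappa> (y - s)) * exp (4 * K)"
      using h\<kappa> hK K0 \<kappa> by (intro mult_mono) auto
    finally show ?thesis .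
  qed
  let ?a = "\<kappa> (s - t)" and ?b = "(\<kappa> (x - s) + \<kappa> (y - s)) * (\<kappa> (x - t) + \<kappa> (y - t))"
  have near: "\<bar>exp (- h s) * exp (- h t) * (exp (C (s - t)) - 1)\<bar> \<le> exp (9 * K) * (K * ?a)"
  proof -
    have "exp (- h s) * exp (- h t) \<le> exp (8 * K)"
      using hK[of s] hK[of t] by (simp flip: exp_add)
    moreover have "\<bar>exp (C (s - t)) - 1\<bar> \<le> K * \<kappa> (s - t) * exp K"
      using abs_exp_minus_one_le[of "C (s - t)"]
      by (rule order_trans) (use C\<kappa> CK K0 \<kappa> in \<open>intro mult_mono; simp\<close>)
    ultimately have "\<bar>exp (- h s) * exp (- h t) * (exp (C (s - t)) - 1)\<bar> \<le> exp (8 * K) * (K * \<kappa> (s - t) * exp K)"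
      unfolding abs_mult abs_exp_cancel by (intro mult_mono) auto
    also have "\<dots> = (exp (8 * K) * exp K) * (K * ?a)"
      by (simp only: mult_ac)
    also have "exp (8 * K) * exp K = exp (9 * K)"
      by (simp flip: exp_add)
    finally show ?thesis .
  qed
  have far: "\<bar>(exp (- h s) - 1) * (exp (- h t) - 1)\<bar> \<le> exp (8 * K) * (4 * K\<^sup>2 * ?b)"
  proof -
    have "\<bar>(exp (- h s) - 1) * (exp (- h t) - 1)\<bar>
      \<le> (2 * K * (\<kappa> (x - s) + \<kappa> (y - s)) * exp (4 * K)) * (2 * K * (\<kappa> (x - t) + \<kappa> (y - t)) * exp (4 * K))"
      unfolding abs_mult using K0 \<kappa> by (intro mult_mono eh) auto
    also have "\<dots> = (exp (4 * K) * exp (4 * K)) * (4 * K\<^sup>2 * ?b)"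
      by (simp add: power2_eq_square)
    also have "exp (4 * K) * exp (4 * K) = exp (8 * K)"
      by (simp flip: exp_add)
    finally show ?thesis .
  qed
  have "\<bar>exp (- h s) * exp (- h t) * (exp (C (s - t)) - 1) + (exp (- h s) - 1) * (exp (- h t) - 1)\<bar>
    \<le> exp (9 * K) * (K * ?a) + exp (8 * K) * (4 * K\<^sup>2 * ?b)"
    by (rule order_trans[OF abs_triangle_ineq add_mono[OF near far]])
  also have "\<dots> \<le> exp (9 * K) * ((K + 4 * K\<^sup>2) * ?a) + exp (9 * K) * ((K + 4 * K\<^sup>2) * ?b)"
    using K0 \<kappa> by (intro add_mono mult_mono) auto
  finally have bracket: "\<bar>exp (- h s) * exp (- h t) * (exp (C (s - t)) - 1) + (exp (- h s) - 1) * (exp (- h t) - 1)\<bar>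
    \<le> exp (9 * K) * ((K + 4 * K\<^sup>2) * (?a + ?b))"
    by (simp add: distrib_left)
  have "exp (4 * C 0 - 4 * C (x - y)) * (exp (C 0 / 2))\<^sup>2 \<le> exp (9 * K)"
    using CK[of 0] CK[of "x - y"] by (simp add: power2_eq_square flip: exp_add)
  then have "\<bar>exp (4 * C 0 - 4 * C (x - y)) * (exp (C 0 / 2))\<^sup>2 *
      (exp (- h s) * exp (- h t) * (exp (C (s - t)) - 1) + (exp (- h s) - 1) * (exp (- h t) - 1))\<bar>
    \<le> exp (9 * K) * (exp (9 * K) * ((K + 4 * K\<^sup>2) * (?a + ?b)))"
    unfolding abs_mult[of "exp (4 * C 0 - 4 * C (x - y)) * (exp (C 0 / 2))\<^sup>2"]
    by (intro mult_mono bracket) auto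
  also have "\<dots> = (exp (9 * K) * exp (9 * K)) * (K + 4 * K\<^sup>2) * (?a + ?b)"
    by (simp only: mult.assoc)
  also have "exp (9 * K) * exp (9 * K) = exp (18 * K)"
    by (simp flip: exp_add)
  finally show ?thesis
    unfolding tilted_covariance(2) h_def .
qed

text \<open>Schur's test applied to the tilted covariance. The tilting points only add to the correlation kernel
a product of two factors bounded by two, each a sum of two kernels of the same type; hence the row
integrals are at most five times the bound on the mean of the kernel, and the factor five is \<open>1 + 2 (1 + 1)\<close>. The case
\<^term>\<open>x = y\<close> is the estimate without weight.\<close>

lemma tilted_fluctuation_le_rate:
  assumes joint: "(\<lambda>(\<omega>, s). G s \<omega>) \<in> borel_measurable (P \<Otimes>\<^sub>M borel)"
    and decay: "\<And>z. \<bar>C z\<bar> \<le> K * (1 + \<bar>z\<bar>) powr (- \<beta>)" and \<beta>: "\<beta> > 0"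
  obtains M where "M \<ge> 0"
    and "\<And>\<epsilon> x y g D. \<lbrakk>0 < \<epsilon>; \<epsilon> \<le> 1/2; x \<in> {0..1}; y \<in> {0..1}; g \<in> borel_measurable unit_leb;
      \<And>s. s \<in> {0..1} \<Longrightarrow> \<bar>g s\<bar> \<le> D\<rbrakk> \<Longrightarrow>
      (\<integral>\<^sup>+\<omega>. ennreal (exp (2 * G (y / \<epsilon>) \<omega> - 2 * G (x / \<epsilon>) \<omega>) *
          (\<integral>s. (exp (- G (s / \<epsilon>) \<omega>) - exp (C 0 / 2)) * g s \<partial>unit_leb)\<^sup>2) \<partial>P)
      \<le> ennreal (M * (rate \<beta> \<epsilon>)\<^sup>2 * (\<integral>s. (g s)\<^sup>2 \<partial>unit_leb))"
proof -
  obtain c where c: "c > 0" and kernel: "\<And>\<epsilon> x. 0 < \<epsilon> \<Longrightarrow> \<epsilon> \<le> 1/2 \<Longrightarrow> x \<in> {0..1} \<Longrightarrow>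
      (\<integral>t. (1 + \<bar>(x - t) / \<epsilon>\<bar>) powr (- \<beta>) \<partial>unit_leb) \<le> c * (rate \<beta> \<epsilon>)\<^sup>2"
    using integral_power_kernel_le_rate[OF \<beta>] by blast
  have K0: "0 \<le> K"
    using decay[of 0] by simp
  define M where "M = exp (18 * K) * (K + 4 * K\<^sup>2)"
  have M: "0 \<le> M"
    using K0 by (simp add: M_def)
  show ?thesis
  proof (rule that)
    show "0 \<le> M * (5 * c)"
      using M c by simp
    fix \<epsilon> x y :: real and g :: "real \<Rightarrow> real" and D :: real
    assume \<epsilon>: "0 < \<epsilon>" "\<epsilon> \<le> 1/2" and x: "x \<in> {0..1}" and y: "y \<in> {0..1}"
      and g: "g \<in> borel_measurable unit_leb" "\<And>s. s \<in> {0..1} \<Longrightarrow> \<bar>g s\<bar> \<le> D"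
    define \<kappa> where "\<kappa> = (\<lambda>z::real. (1 + \<bar>z / \<epsilon>\<bar>) powr (- \<beta>))"
    have \<kappa>: "0 \<le> \<kappa> z" "\<kappa> z \<le> 1" for z
      unfolding \<kappa>_def by (rule powr_ge_zero power_kernel_le_one \<beta>)+
    have [measurable]: "\<kappa> \<in> borel_measurable borel"
      unfolding \<kappa>_def by measurable
    define k where "k = (\<lambda>s. \<kappa> (x - s) + \<kappa> (y - s))"
    have k: "0 \<le> k s" "k s \<le> 2" for s
      using \<kappa>[of "x - s"] \<kappa>[of "y - s"] by (auto simp: k_def)
    define \<rho> where "\<rho> = (\<lambda>s t. M * (\<kappa> (s - t) + k s * k t))"
    define W where "W = (\<lambda>\<omega>. exp (2 * G (y / \<epsilon>) \<omega> - 2 * G (x / \<epsilon>) \<omega>))"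
    define Y where "Y = (\<lambda>\<omega> s. exp (- G (s / \<epsilon>) \<omega>) - exp (C 0 / 2))"
    have scaled: "(\<lambda>p. G (snd p / \<epsilon>) (fst p)) \<in> borel_measurable (P \<Otimes>\<^sub>M unit_leb)"
    proof -
      have m: "(\<lambda>p. (fst p, snd p / \<epsilon>)) \<in> P \<Otimes>\<^sub>M unit_leb \<rightarrow>\<^sub>M P \<Otimes>\<^sub>M borel"
        by (intro measurable_Pair measurable_fst measurable_compose[OF measurable_snd measurable_unit_leb]) auto
      show ?thesis
        using measurable_compose[OF m joint] by simp
    qed
    have Gm [measurable]: "G z \<in> borel_measurable P" for z
      using measurable_compose[OF _ joint, of "\<lambda>\<omega>. (\<omega>, z)" P] by simp
    have Ym: "case_prod Y \<in> borel_measurable (P \<Otimes>\<^sub>M unit_leb)"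
      unfolding Y_def case_prod_beta' using scaled by measurable
    have fm: "finite_measure unit_leb"
      by unfold_locales
    have Wm: "W \<in> borel_measurable P"
      unfolding W_def by measurable
    have int: "integrable P (\<lambda>\<omega>. W \<omega> * (Y \<omega> s * Y \<omega> t))" for s t
      unfolding W_def Y_def by (rule tilted_covariance(1))
    have cov: "\<bar>\<integral>\<omega>. W \<omega> * (Y \<omega> s * Y \<omega> t) \<partial>P\<bar> \<le> \<rho> s t" for s t
      using tilted_covariance_le[OF decay \<beta>, of "y / \<epsilon>" "x / \<epsilon>" "s / \<epsilon>" "t / \<epsilon>"]
      unfolding W_def Y_def \<rho>_def k_def \<kappa>_def M_def by (simp only: diff_divide_distrib)
    have coords [measurable]: "(\<lambda>p. fst p) \<in> borel_measurable (unit_leb \<Otimes>\<^sub>M unit_leb)"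
        "(\<lambda>p. snd p) \<in> borel_measurable (unit_leb \<Otimes>\<^sub>M unit_leb)"
      using measurable_compose[OF measurable_fst measurable_unit_leb[OF measurable_ident_sets[OF refl]]]
        measurable_compose[OF measurable_snd measurable_unit_leb[OF measurable_ident_sets[OF refl]]] by auto
    have rm: "case_prod \<rho> \<in> borel_measurable (unit_leb \<Otimes>\<^sub>M unit_leb)"
      unfolding \<rho>_def k_def case_prod_beta' by measurable
    have sym: "\<rho> s t = \<rho> t s" for s t
      unfolding \<rho>_def \<kappa>_def by (simp add: mult.commute abs_minus_commute)
    have bd: "\<rho> s t \<le> M * 5" for s t
    proof -
      have "k s * k t \<le> 2 * 2"
        using k by (intro mult_mono) auto
      then show ?thesis
        unfolding \<rho>_def using \<kappa>[of "s - t"] M by (intro mult_left_mono) auto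
    qed
    have R: "(\<integral>t. \<rho> s t \<partial>unit_leb) \<le> M * (5 * c * (rate \<beta> \<epsilon>)\<^sup>2)" if s: "s \<in> space unit_leb" for s
    proof -
      have i: "integrable unit_leb (\<lambda>t. \<kappa> (z - t))" for z
        by (rule unit_leb.integrable_const_bound[of _ 1]) (auto simp: \<kappa>)
      have ker: "(\<integral>t. \<kappa> (z - t) \<partial>unit_leb) \<le> c * (rate \<beta> \<epsilon>)\<^sup>2" if "z \<in> {0..1}" for z
        unfolding \<kappa>_def by (rule kernel[OF \<epsilon> that])
      have "(\<integral>t. \<rho> s t \<partial>unit_leb) = M * ((\<integral>t. \<kappa> (s - t) \<partial>unit_leb) + k s * ((\<integral>t. \<kappa> (x - t) \<partial>unit_leb) + (\<integral>t. \<kappa> (y - t) \<partial>unit_leb)))"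
        unfolding \<rho>_def using i by (simp add: k_def)
      also have "\<dots> \<le> M * (c * (rate \<beta> \<epsilon>)\<^sup>2 + 2 * (c * (rate \<beta> \<epsilon>)\<^sup>2 + c * (rate \<beta> \<epsilon>)\<^sup>2))"
        using ker[of s] ker[of x] ker[of y] k s x y c M \<kappa>
        by (intro mult_left_mono add_mono mult_mono) (auto intro!: add_nonneg_nonneg Bochner_Integration.integral_nonneg)
      finally show ?thesis
        by (simp add: algebra_simps)
    qed
    note schur = second_moment_of_integral_Schur[OF P fm Ym Wm _ int cov rm sym bd R g(1), of D]
    have int: "integrable P (\<lambda>\<omega>. W \<omega> * (\<integral>s. Y \<omega> s * g s \<partial>unit_leb)\<^sup>2)"
      by (rule schur(1)) (use g(2) in \<open>auto simp: W_def\<close>)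
    have "(\<integral>\<omega>. W \<omega> * (\<integral>s. Y \<omega> s * g s \<partial>unit_leb)\<^sup>2 \<partial>P) \<le> (M * (5 * c * (rate \<beta> \<epsilon>)\<^sup>2)) * (\<integral>s. (g s)\<^sup>2 \<partial>unit_leb)"
      by (rule schur(2)) (use g(2) in \<open>auto simp: W_def\<close>)
    then show "(\<integral>\<^sup>+\<omega>. ennreal (exp (2 * G (y / \<epsilon>) \<omega> - 2 * G (x / \<epsilon>) \<omega>) *
          (\<integral>s. (exp (- G (s / \<epsilon>) \<omega>) - exp (C 0 / 2)) * g s \<partial>unit_leb)\<^sup>2) \<partial>P)
      \<le> ennreal (M * (5 * c) * (rate \<beta> \<epsilon>)\<^sup>2 * (\<integral>s. (g s)\<^sup>2 \<partial>unit_leb))"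
      using int unfolding W_def Y_def
      by (subst nn_integral_eq_integral) (auto intro!: ennreal_leI simp: mult_ac)
  qed
qed

end

section \<open>Homogenization of the log-normal coefficient\<close>

text \<open>Evaluating the field at the grid point below \<^term>\<open>x\<close> involves only countably many measurable functions,
and continuity lets the grid be refined.\<close>

lemma borel_measurable_joint_if_continuous:
  fixes G :: "real \<Rightarrow> 'w \<Rightarrow> real"
  assumes meas: "\<And>x. G x \<in> borel_measurable P"
    and cont: "\<And>\<omega>. \<omega> \<in> space P \<Longrightarrow> continuous_on UNIV (\<lambda>x. G x \<omega>)"
  shows "(\<lambda>(\<omega>, x). G x \<omega>) \<in> borel_measurable (P \<Otimes>\<^sub>M borel)"
proof (rule borel_measurable_LIMSEQ_real)
  let ?q = "\<lambda>(n::nat) x. real_of_int \<lfloor>real (Suc n) * x\<rfloor> / real (Suc n)"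
  show "(\<lambda>(\<omega>, x). G (?q n x) \<omega>) \<in> borel_measurable (P \<Otimes>\<^sub>M borel)" for n
  proof -
    have "(\<lambda>p. G (real_of_int i / real (Suc n)) (fst p)) \<in> borel_measurable (P \<Otimes>\<^sub>M borel)" for i :: int
      using meas by (rule measurable_compose[OF measurable_fst])
    moreover have "(\<lambda>p. \<lfloor>real (Suc n) * snd p\<rfloor>) \<in> P \<Otimes>\<^sub>M (borel :: real measure) \<rightarrow>\<^sub>M count_space UNIV"
      by measurable
    ultimately have "(\<lambda>p. G (?q n (snd p)) (fst p)) \<in> borel_measurable (P \<Otimes>\<^sub>M borel)"
      by (rule measurable_compose_countable)
    then show ?thesis
      by (simp add: case_prod_beta')
  qed
  fix p assume "p \<in> space (P \<Otimes>\<^sub>M (borel :: real measure))"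
  then obtain \<omega> x where p: "p = (\<omega>, x)" and \<omega>: "\<omega> \<in> space P"
    by (auto simp: space_pair_measure)
  have "(\<lambda>n. ?q n x) \<longlonglongrightarrow> x"
  proof (rule tendsto_sandwich)
    have n: "(\<lambda>n. 1 / real (Suc n)) \<longlonglongrightarrow> 0"
      using LIMSEQ_inverse_real_of_nat by (simp add: inverse_eq_divide)
    show "(\<lambda>n. x - 1 / real (Suc n)) \<longlonglongrightarrow> x"
      using tendsto_diff[OF tendsto_const n, of x] by simp
    have "real (Suc n) * x \<le> real_of_int \<lfloor>real (Suc n) * x\<rfloor> + 1" "real_of_int \<lfloor>real (Suc n) * x\<rfloor> \<le> real (Suc n) * x" for n
      by linarith+
    then have "x - 1 / real (Suc n) \<le> ?q n x" "?q n x \<le> x" for n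
      by (simp_all add: divide_simps mult.commute del: of_nat_Suc)
    then show "\<forall>\<^sub>F n in sequentially. x - 1 / real (Suc n) \<le> ?q n x" "\<forall>\<^sub>F n in sequentially. ?q n x \<le> x"
      by auto
  qed auto
  moreover have "isCont (\<lambda>x. G x \<omega>) x"
    using cont[OF \<omega>] by (simp add: continuous_on_eq_continuous_at)
  ultimately show "(\<lambda>n. (\<lambda>(\<omega>, x). G (?q n x) \<omega>) p) \<longlonglongrightarrow> (\<lambda>(\<omega>, x). G x \<omega>) p"
    unfolding p by (auto intro: isCont_tendsto_compose)
qed

text \<open>Fubini needs joint measurability, which continuity of every path provides. Setting the field to zero on a
measurable null set containing the discontinuous outcomes keeps its law.\<close>

lemma continuous_modification:
  fixes G :: "real \<Rightarrow> 'w \<Rightarrow> real"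
  assumes P: "prob_space P" and G: "stationary_centered_gaussian_field P G C"
    and cont: "AE \<omega> in P. continuous_on UNIV (\<lambda>x. G x \<omega>)"
  obtains G' where "stationary_centered_gaussian_field P G' C"
    and "\<And>\<omega>. continuous_on UNIV (\<lambda>x. G' x \<omega>)"
    and "AE \<omega> in P. \<forall>x. G' x \<omega> = G x \<omega>"
    and "\<And>x. G' x \<in> borel_measurable P"
proof -
  have field: "gaussian_field P G"
    and mean: "\<And>x. (\<integral>\<omega>. G x \<omega> \<partial>P) = 0" and cov: "\<And>x y. (\<integral>\<omega>. G x \<omega> * G y \<omega> \<partial>P) = C (x - y)"
    using G by (auto simp: stationary_centered_gaussian_field_def)
  have "gaussian_rv P (G x)" for x
    using gaussian_rv_weighted_sum[OF field, of "{()}" "\<lambda>_. 1" "\<lambda>_. x"] by simp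
  then have Gm [measurable]: "G x \<in> borel_measurable P" for x
    by (simp add: gaussian_rv_def)
  obtain N where N: "N \<in> null_sets P" "{\<omega> \<in> space P. \<not> continuous_on UNIV (\<lambda>x. G x \<omega>)} \<subseteq> N"
    using cont by (rule AE_E) (auto intro: null_setsI)
  define S where "S = space P - N"
  have S [measurable]: "S \<in> sets P"
    using N(1) by (auto simp: S_def)
  define G' where "G' = (\<lambda>x \<omega>. if \<omega> \<in> S then G x \<omega> else 0)"
  have m [measurable]: "G' x \<in> borel_measurable P" for x
    unfolding G'_def by measurable
  have ae: "AE \<omega> in P. \<forall>x. G' x \<omega> = G x \<omega>"
    using AE_not_in[OF N(1)] AE_space by eventually_elim (auto simp: G'_def S_def)
  have "stationary_centered_gaussian_field P G' C"
    unfolding stationary_centered_gaussian_field_def gaussian_field_def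
  proof (intro conjI allI impI)
    fix I :: "real set" and c :: "real \<Rightarrow> real" assume "finite I"
    then have "gaussian_rv P (\<lambda>\<omega>. \<Sum>x\<in>I. c x * G x \<omega>)"
      using field by (simp add: gaussian_field_def)
    then show "gaussian_rv P (\<lambda>\<omega>. \<Sum>x\<in>I. c x * G' x \<omega>)"
      by (rule gaussian_rv_cong_AE) (use ae in auto)
  next
    show "(\<integral>\<omega>. G' x \<omega> \<partial>P) = 0" for x
      unfolding mean[of x, symmetric] by (rule integral_cong_AE) (use ae in auto)
    show "(\<integral>\<omega>. G' x \<omega> * G' y \<omega> \<partial>P) = C (x - y)" for x y
      unfolding cov[of x y, symmetric] by (rule integral_cong_AE) (use ae in auto)
  qed
  moreover have "continuous_on UNIV (\<lambda>x. G' x \<omega>)" for \<omega>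
    using N(2) by (cases "\<omega> \<in> S") (auto simp: G'_def S_def)
  ultimately show ?thesis
    using that ae m by blast
qed

text \<open>The random solution solves its equation only almost surely and may be non-measurable in \<open>\<omega>\<close>; the
integral on the left, a supremum over simple functions from below, is monotone for such functions too.\<close>

lemma L2_norm_prob_le:
  assumes "(\<integral>\<^sup>+\<omega>. ennreal ((X \<omega>)\<^sup>2) \<partial>P) \<le> ennreal (r\<^sup>2)" "0 \<le> r"
  shows "L2_norm_prob P X \<le> ennreal r"
proof -
  have "(\<integral>\<^sup>+\<omega>. ennreal (\<bar>X \<omega>\<bar>\<^sup>2) \<partial>P) \<le> ennreal (r\<^sup>2)"
    using assms(1) by simp
  moreover from this have "enn2real (\<integral>\<^sup>+\<omega>. ennreal (\<bar>X \<omega>\<bar>\<^sup>2) \<partial>P) \<le> r\<^sup>2"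
    by (metis enn2real_leI zero_le_power2)
  then have "sqrt (enn2real (\<integral>\<^sup>+\<omega>. ennreal (\<bar>X \<omega>\<bar>\<^sup>2) \<partial>P)) \<le> r"
    using assms(2) by (rule real_le_lsqrt[rotated -1])
  ultimately show ?thesis
    unfolding L2_norm_prob_def Let_def by (auto intro: ennreal_leI simp: top_unique)
qed

theorem theorem4p1:
  fixes P :: "'w measure"
    and G :: "real \<Rightarrow> 'w \<Rightarrow> real"
    and C C0 :: "real \<Rightarrow> real"
    and \<beta> K abar :: real
    and a :: "real \<Rightarrow> 'w \<Rightarrow> real"
  assumes "prob_space P"
    and "\<beta> > 0"
    and "stationary_centered_gaussian_field P G C"
    and "AE \<omega> in P. continuous_on UNIV (\<lambda>x. G x \<omega>)"
    and "holder_continuous_at_zero C"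
    and "\<And>x. \<bar>C x\<bar> \<le> K * (1 + \<bar>x\<bar>) powr (- \<beta>)"
    and "C0 \<in> borel_measurable lebesgue"
    and "C = fun_convolution C0 C0"
    and "\<And>x. (SUP y\<in>ball x 1. ereal \<bar>C0 y\<bar>)
               \<le> ereal (K * (1 + \<bar>x\<bar>) powr (- ((1 + \<beta>) / 2)) * ell \<beta> x)"
    and a_def: "\<And>x \<omega>. a x \<omega> = exp (G x \<omega>)"
    and abar_def: "abar = exp (- C 0 / 2)"
  shows "\<exists>M::real. \<forall>f \<epsilon> u ubar.
           C1_on01 f \<longrightarrow> 0 < \<epsilon> \<longrightarrow> \<epsilon> \<le> 1/2 \<longrightarrow>
           (AE \<omega> in P. dirichlet_solution (\<lambda>x. a (x / \<epsilon>) \<omega>) f (u \<omega>)) \<longrightarrow>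
           dirichlet_solution (\<lambda>x. abar) f ubar \<longrightarrow>
           (\<forall>x\<in>{0..1}.
              L2_norm_prob P (\<lambda>\<omega>. u \<omega> x - ubar x)
              + L2_norm_prob P (\<lambda>\<omega>. deriv01 (u \<omega>) x - deriv01 ubar x * (abar / a (x / \<epsilon>) \<omega>))
              \<le> ennreal (M * L2_norm01 f * rate \<beta> \<epsilon>))"
proof -
  interpret prob_space P by fact
  interpret PU: pair_sigma_finite unit_leb P ..
  obtain G' where field: "stationary_centered_gaussian_field P G' C"
    and cont: "\<And>\<omega>. continuous_on UNIV (\<lambda>x. G' x \<omega>)"
    and ae: "AE \<omega> in P. \<forall>x. G' x \<omega> = G x \<omega>" and Gm [measurable]: "\<And>x. G' x \<in> borel_measurable P"
    using continuous_modification[OF assms(1,3,4)] by blast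
  have joint: "(\<lambda>(\<omega>, x). G' x \<omega>) \<in> borel_measurable (P \<Otimes>\<^sub>M borel)"
    by (rule borel_measurable_joint_if_continuous[OF Gm cont])
  define B where "B = exp (C 0 / 2)"
  have B: "B > 0" "1 / B = abar"
    by (simp_all add: B_def abar_def exp_minus field_simps)
  obtain M where M: "M \<ge> 0" and fluct: "\<And>\<epsilon> x y g D. \<lbrakk>0 < \<epsilon>; \<epsilon> \<le> 1/2; x \<in> {0..1}; y \<in> {0..1};
      g \<in> borel_measurable unit_leb; \<And>s. s \<in> {0..1} \<Longrightarrow> \<bar>g s\<bar> \<le> D\<rbrakk> \<Longrightarrow>
      (\<integral>\<^sup>+\<omega>. ennreal (exp (2 * G' (y / \<epsilon>) \<omega> - 2 * G' (x / \<epsilon>) \<omega>) *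
          (\<integral>s. (exp (- G' (s / \<epsilon>) \<omega>) - B) * g s \<partial>unit_leb)\<^sup>2) \<partial>P)
      \<le> ennreal (M * (rate \<beta> \<epsilon>)\<^sup>2 * (\<integral>s. (g s)\<^sup>2 \<partial>unit_leb))"
    using tilted_fluctuation_le_rate[OF assms(1) field joint assms(6) assms(2)] unfolding B_def by blast
  show ?thesis
  proof (intro exI[of _ "3 * sqrt M"] allI impI ballI)
    fix f \<epsilon> u ubar x
    assume f: "C1_on01 f" and \<epsilon>: "0 < \<epsilon>" "\<epsilon> \<le> 1/2"
      and u: "AE \<omega> in P. dirichlet_solution (\<lambda>x. a (x / \<epsilon>) \<omega>) f (u \<omega>)"
      and ubar: "dirichlet_solution (\<lambda>x. abar) f ubar" and x: "x \<in> {0..1::real}"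
    define b where "b = (\<lambda>\<omega> s. exp (- G' (s / \<epsilon>) \<omega>))"
    define F where "F = (\<integral>t. f t \<partial>unit_leb)"
    define g where "g = (\<lambda>s. f s - F)"
    define Z where "Z = (\<lambda>\<omega> x. \<integral>s. (b \<omega> s - B) * (indicator {0..x} s * g s) \<partial>unit_leb)"
    define r where "r = sqrt M * L2_norm01 f * rate \<beta> \<epsilon>"
    have b: "continuous_on {0..1} (b \<omega>)" "b \<omega> s > 0" for \<omega> s
      unfolding b_def using \<epsilon>
      by (auto intro!: continuous_intros continuous_on_compose2[OF cont])
    have fc: "continuous_on {0..1} f"
      by (rule C1_on01_continuous[OF f])
    have gc: "continuous_on {0..1} g"
      unfolding g_def by (intro continuous_intros fc)
    have gm [measurable]: "g \<in> borel_measurable unit_leb"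
      by (rule continuous_imp_measurable_unit_leb[OF gc])
    obtain D where D: "\<forall>s\<in>{0..1}. \<bar>g s\<bar> \<le> D"
      using compact_imp_bounded[OF compact_continuous_image[OF gc]] by (auto simp: bounded_iff)
    have Lf: "0 \<le> L2_norm01 f"
      unfolding L2_norm01_def set_lebesgue_integral_def by (auto intro!: Bochner_Integration.integral_nonneg)
    have rate: "0 \<le> rate \<beta> \<epsilon>"
      using \<epsilon> by (simp add: rate_def)
    have r: "0 \<le> r"
      using M Lf rate by (simp add: r_def)
    have g_le: "(\<integral>s. (indicator {0..y} s * g s)\<^sup>2 \<partial>unit_leb) \<le> (L2_norm01 f)\<^sup>2" for y
    proof -
      have i: "integrable unit_leb f" "integrable unit_leb (\<lambda>s. (f s)\<^sup>2)" "integrable unit_leb (\<lambda>s. (g s)\<^sup>2)"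
        by (intro integrable_unit_leb continuous_intros fc gc)+
      have "(\<integral>s. (indicator {0..y} s * g s)\<^sup>2 \<partial>unit_leb) \<le> (\<integral>s. (g s)\<^sup>2 \<partial>unit_leb)"
        by (rule integral_mono'[OF i(3)]) (auto simp: indicator_def)
      \<comment> \<open>Subtracting the mean does not increase the norm.\<close>
      also have "\<dots> = (\<integral>s. (f s)\<^sup>2 - 2 * F * f s + F\<^sup>2 \<partial>unit_leb)"
        by (simp add: g_def power2_diff algebra_simps)
      also have "\<dots> = (\<integral>s. (f s)\<^sup>2 \<partial>unit_leb) - F\<^sup>2"
        using i by (simp add: unit_leb.prob_space[simplified] flip: F_def) (simp add: power2_eq_square)
      also have "\<dots> \<le> (L2_norm01 f)\<^sup>2"
        by (simp add: L2_norm01_unit_leb[OF fc])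
      finally show ?thesis .
    qed
    have tilt: "(\<integral>\<^sup>+\<omega>. ennreal ((b \<omega> z)\<^sup>2 * (1 / (b \<omega> y)\<^sup>2) * (Z \<omega> w)\<^sup>2) \<partial>P) \<le> ennreal (r\<^sup>2)"
      if zy: "z \<in> {0..1}" "y \<in> {0..1}" for z y w
    proof -
      have "(b \<omega> z)\<^sup>2 * (1 / (b \<omega> y)\<^sup>2) = exp (2 * G' (y / \<epsilon>) \<omega> - 2 * G' (z / \<epsilon>) \<omega>)" for \<omega>
        unfolding b_def by (simp add: exp_minus exp_diff exp_double field_simps)
      then have "(\<integral>\<^sup>+\<omega>. ennreal ((b \<omega> z)\<^sup>2 * (1 / (b \<omega> y)\<^sup>2) * (Z \<omega> w)\<^sup>2) \<partial>P)
        \<le> ennreal (M * (rate \<beta> \<epsilon>)\<^sup>2 * (\<integral>s. (indicator {0..w} s * g s)\<^sup>2 \<partial>unit_leb))"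
        unfolding Z_def b_def
        by (simp only:, intro fluct[OF \<epsilon> zy, of _ D])
          (measurable, use D in \<open>auto simp: indicator_def intro: order_trans[OF abs_ge_zero]\<close>)
      also have "\<dots> \<le> ennreal (M * (rate \<beta> \<epsilon>)\<^sup>2 * (L2_norm01 f)\<^sup>2)"
        using M by (intro ennreal_leI mult_left_mono g_le) auto
      also have "M * (rate \<beta> \<epsilon>)\<^sup>2 * (L2_norm01 f)\<^sup>2 = r\<^sup>2"
        using M by (simp add: r_def power_mult_distrib)
      finally show ?thesis .
    qed
    have scaled: "(\<lambda>(s, \<omega>). b \<omega> s) \<in> borel_measurable (unit_leb \<Otimes>\<^sub>M P)"
    proof -
      have m: "(\<lambda>p. (snd p, fst p / \<epsilon>)) \<in> unit_leb \<Otimes>\<^sub>M P \<rightarrow>\<^sub>M P \<Otimes>\<^sub>M borel"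
        by (intro measurable_Pair measurable_snd measurable_compose[OF measurable_fst measurable_unit_leb]) auto
      have "(\<lambda>p. G' (fst p / \<epsilon>) (snd p)) \<in> borel_measurable (unit_leb \<Otimes>\<^sub>M P)"
        using measurable_compose[OF m joint] by simp
      then show ?thesis
        unfolding b_def case_prod_beta' by measurable
    qed
    have scaled' [measurable]: "(\<lambda>(\<omega>, s). b \<omega> s) \<in> borel_measurable (P \<Otimes>\<^sub>M unit_leb)"
      using measurable_pair_swap[OF scaled] by simp
    have bm [measurable]: "(\<lambda>\<omega>. b \<omega> s) \<in> borel_measurable P" for s
      unfolding b_def by measurable
    have Zm [measurable]: "(\<lambda>\<omega>. Z \<omega> w) \<in> borel_measurable P" for w
    proof -
      have [measurable]: "(\<lambda>s. indicator {0..w} s * g s) \<in> borel_measurable unit_leb"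
        by measurable
      show ?thesis
        unfolding Z_def by measurable
    qed
    have path: "AE \<omega> in P. (u \<omega> x - ubar x)\<^sup>2 \<le> 2 * (Z \<omega> x)\<^sup>2 + 2 * (Z \<omega> 1)\<^sup>2 \<and>
        (deriv01 (u \<omega>) x - deriv01 ubar x * (abar / a (x / \<epsilon>) \<omega>))\<^sup>2
        \<le> (b \<omega> x)\<^sup>2 * (\<integral>s. 1 / (b \<omega> s)\<^sup>2 \<partial>unit_leb) * (Z \<omega> 1)\<^sup>2"
      using ae u
    proof eventually_elim
      case (elim \<omega>)
      have ab: "a (s / \<epsilon>) \<omega> = 1 / b \<omega> s" for s
        using elim(1) by (simp add: a_def b_def exp_minus field_simps)
      show ?case
        using homogenization_error_pathwise[OF f b B(1) elim(2)[unfolded ab] ubar[folded B(2)] x]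
        unfolding Z_def g_def F_def ab by (simp flip: B(2))
    qed
    have "(\<integral>\<^sup>+\<omega>. ennreal ((u \<omega> x - ubar x)\<^sup>2) \<partial>P) \<le> (\<integral>\<^sup>+\<omega>. 2 * ennreal ((Z \<omega> x)\<^sup>2) + 2 * ennreal ((Z \<omega> 1)\<^sup>2) \<partial>P)"
    proof (rule nn_integral_mono_AE)
      show "AE \<omega> in P. ennreal ((u \<omega> x - ubar x)\<^sup>2) \<le> 2 * ennreal ((Z \<omega> x)\<^sup>2) + 2 * ennreal ((Z \<omega> 1)\<^sup>2)"
        using path by eventually_elim (auto simp flip: ennreal_plus ennreal_mult' ennreal_numeral intro!: ennreal_leI)
    qed
    also have "\<dots> = 2 * (\<integral>\<^sup>+\<omega>. ennreal ((Z \<omega> x)\<^sup>2) \<partial>P) + 2 * (\<integral>\<^sup>+\<omega>. ennreal ((Z \<omega> 1)\<^sup>2) \<partial>P)"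
      by (simp add: nn_integral_add nn_integral_cmult)
    also have "\<dots> \<le> 2 * ennreal (r\<^sup>2) + 2 * ennreal (r\<^sup>2)"
    proof -
      \<comment> \<open>Equal tilting points make the weight one.\<close>
      have "(\<integral>\<^sup>+\<omega>. ennreal ((Z \<omega> w)\<^sup>2) \<partial>P) \<le> ennreal (r\<^sup>2)" for w
        using tilt[OF x x, of w] b(2)[of _ x] by (simp add: less_imp_neq[symmetric])
      then show ?thesis
        by (intro add_mono mult_left_mono) auto
    qed
    also have "\<dots> = ennreal ((2 * r)\<^sup>2)"
      by (simp add: power_mult_distrib flip: ennreal_plus ennreal_mult' ennreal_numeral)
    finally have 1: "L2_norm_prob P (\<lambda>\<omega>. u \<omega> x - ubar x) \<le> ennreal (2 * r)"
      using r by (intro L2_norm_prob_le) auto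
    have "(\<integral>\<^sup>+\<omega>. ennreal ((deriv01 (u \<omega>) x - deriv01 ubar x * (abar / a (x / \<epsilon>) \<omega>))\<^sup>2) \<partial>P)
      \<le> (\<integral>\<^sup>+\<omega>. ennreal ((b \<omega> x)\<^sup>2 * (\<integral>s. 1 / (b \<omega> s)\<^sup>2 \<partial>unit_leb) * (Z \<omega> 1)\<^sup>2) \<partial>P)"
      using path by (intro nn_integral_mono_AE) (auto intro: ennreal_leI)
    \<comment> \<open>Average over the second tilting point, so that for each value of it the weight is a single exponential.\<close>
    also have "\<dots> = (\<integral>\<^sup>+\<omega>. (\<integral>\<^sup>+y. ennreal ((b \<omega> x)\<^sup>2 * (1 / (b \<omega> y)\<^sup>2) * (Z \<omega> 1)\<^sup>2) \<partial>unit_leb) \<partial>P)"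
    proof (intro nn_integral_cong)
      fix \<omega>
      have "integrable unit_leb (\<lambda>y. 1 / (b \<omega> y)\<^sup>2)"
        using b(2)[of \<omega>] by (intro integrable_unit_leb continuous_intros b) (auto simp: less_imp_neq[symmetric])
      then have int: "integrable unit_leb (\<lambda>y. (b \<omega> x)\<^sup>2 * (1 / (b \<omega> y)\<^sup>2) * (Z \<omega> 1)\<^sup>2)"
        by (intro integrable_mult_left integrable_mult_right)
      have eq: "(b \<omega> x)\<^sup>2 * (\<integral>s. 1 / (b \<omega> s)\<^sup>2 \<partial>unit_leb) * (Z \<omega> 1)\<^sup>2
        = (\<integral>y. (b \<omega> x)\<^sup>2 * (1 / (b \<omega> y)\<^sup>2) * (Z \<omega> 1)\<^sup>2 \<partial>unit_leb)"
        by (simp only: integral_mult_left_zero integral_mult_right_zero)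
      show "ennreal ((b \<omega> x)\<^sup>2 * (\<integral>s. 1 / (b \<omega> s)\<^sup>2 \<partial>unit_leb) * (Z \<omega> 1)\<^sup>2)
        = (\<integral>\<^sup>+y. ennreal ((b \<omega> x)\<^sup>2 * (1 / (b \<omega> y)\<^sup>2) * (Z \<omega> 1)\<^sup>2) \<partial>unit_leb)"
        unfolding eq by (rule nn_integral_eq_integral[OF int, symmetric]) simp
    qed
    also have "\<dots> = (\<integral>\<^sup>+y. (\<integral>\<^sup>+\<omega>. ennreal ((b \<omega> x)\<^sup>2 * (1 / (b \<omega> y)\<^sup>2) * (Z \<omega> 1)\<^sup>2) \<partial>P) \<partial>unit_leb)"
    proof (rule PU.Fubini')
      show "(\<lambda>(y, \<omega>). ennreal ((b \<omega> x)\<^sup>2 * (1 / (b \<omega> y)\<^sup>2) * (Z \<omega> 1)\<^sup>2)) \<in> borel_measurable (unit_leb \<Otimes>\<^sub>M P)"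
        using scaled by measurable
    qed
    also have "\<dots> \<le> (\<integral>\<^sup>+y. ennreal (r\<^sup>2) \<partial>unit_leb)"
      using tilt x by (intro nn_integral_mono) auto
    also have "\<dots> = ennreal (r\<^sup>2)"
      by (simp add: unit_leb.emeasure_space_1[simplified])
    finally have 2: "L2_norm_prob P (\<lambda>\<omega>. deriv01 (u \<omega>) x - deriv01 ubar x * (abar / a (x / \<epsilon>) \<omega>)) \<le> ennreal r"
      using r by (intro L2_norm_prob_le)
    have "L2_norm_prob P (\<lambda>\<omega>. u \<omega> x - ubar x)
        + L2_norm_prob P (\<lambda>\<omega>. deriv01 (u \<omega>) x - deriv01 ubar x * (abar / a (x / \<epsilon>) \<omega>))
      \<le> ennreal (2 * r) + ennreal r"
      by (rule add_mono[OF 1 2])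
    also have "\<dots> = ennreal (3 * sqrt M * L2_norm01 f * rate \<beta> \<epsilon>)"
      using r by (simp add: r_def mult_ac flip: ennreal_plus)
    finally show "L2_norm_prob P (\<lambda>\<omega>. u \<omega> x - ubar x)
        + L2_norm_prob P (\<lambda>\<omega>. deriv01 (u \<omega>) x - deriv01 ubar x * (abar / a (x / \<epsilon>) \<omega>))
      \<le> ennreal (3 * sqrt M * L2_norm01 f * rate \<beta> \<epsilon>)" .
  qed
qed

end
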